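(* For every positive integer $m$, there exists an irreducible odd unimodular lattice $L_m$ of rank $24m$ and minimum norm $3$ that is $3$-integrable and generated (over $\mathbb{Z}$) by its minimal vectors.
   Context: All lattices are Euclidean, and the norm of a lattice vector $\mathbf{v}$ is its squared Euclidean length $\mathbf{v}\cdot\mathbf{v}$. Generation of lattices is over $\mathbb{Z}$. For an $n$-dimensional lattice $L$ (of full rank in $\mathbb{R}^n$), the dual lattice is $L^*=\{\mathbf{x}\in\mathbb{R}^n : \mathbf{x}\cdot\mathbf{y}\in\mathbb{Z}\text{ for all }\mathbf{y}\in L\}$. $L$ is unimodular if $L=L^*$. A unimodular lattice is even if all its vectors have even norm, and odd if some vector has odd norm. The minimum norm of $L$ is the smallest norm of a nonzero vector of $L$; $\operatorname{Min}(L)$ is the set of vectors attaining it (the minimal vectors), and $L$ is generated by its minimal vectors if $L=\langle\operatorname{Min}(L)\rangle_{\mathbb{Z}}$. A lattice is irreducible if it admits no orthogonal decomposition into two nonzero sublattices. For a positive integer $s$, a lattice $L$ is $s$-integrable if $\sqrt{s}\,L$ is isometric to a sublattice (of possibly smaller rank) of $\mathbb{Z}^N$ for some positive integer $N$. *)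

theory Defs
  imports
    Complex_Main
    "HOL-Algebra.Generated_Groups"
    "Jordan_Normal_Form.Matrix"
begin

text \<open>Euclidean space of dimension \<open>n\<close> is \<open>carrier_vec n\<close> with \<open>scalar_prod\<close>, so
  that the dimension is a term. The record \<open>monoid_vec\<close> is written multiplicatively: its operation
  is vector addition and its neutral element is the zero vector.\<close>

abbreviation euclid :: "nat \<Rightarrow> real vec monoid" where
  "euclid n \<equiv> monoid_vec TYPE(real) n"

definition int_vecs :: "nat \<Rightarrow> real vec set" where
  "int_vecs n = {v \<in> carrier_vec n. \<forall>i<n. v $ i \<in> \<int>}"

text \<open>A lattice of full rank \<open>n\<close>: the set of integral combinations of the columns of an invertible
  matrix, that is, of a basis of the space.\<close>

definition full_lattice :: "nat \<Rightarrow> real vec set \<Rightarrow> bool" where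
  "full_lattice n L \<longleftrightarrow>
     (\<exists>A \<in> carrier_mat n n. invertible_mat A \<and> L = (\<lambda>z. A *\<^sub>v z) ` int_vecs n)"

text \<open>Sublattices may have smaller rank. Every subgroup of a lattice is again a lattice in its
  linear span, so they are the subgroups.\<close>

definition sublattice :: "nat \<Rightarrow> real vec set \<Rightarrow> real vec set \<Rightarrow> bool" where
  "sublattice n M L \<longleftrightarrow> subgroup M (euclid n) \<and> M \<subseteq> L"

definition vnorm :: "real vec \<Rightarrow> real" where
  "vnorm v = v \<bullet> v"

definition dual_lattice :: "nat \<Rightarrow> real vec set \<Rightarrow> real vec set" where
  "dual_lattice n L = {x \<in> carrier_vec n. \<forall>y\<in>L. x \<bullet> y \<in> \<int>}"

definition unimodular :: "nat \<Rightarrow> real vec set \<Rightarrow> bool" where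
  "unimodular n L \<longleftrightarrow> full_lattice n L \<and> L = dual_lattice n L"

definition odd_unimodular :: "nat \<Rightarrow> real vec set \<Rightarrow> bool" where
  "odd_unimodular n L \<longleftrightarrow>
     unimodular n L \<and> (\<exists>v\<in>L. \<exists>k::int. odd k \<and> vnorm v = of_int k)"

text \<open>The least norm exists for a lattice of positive rank; for other sets the value of
  \<open>min_norm\<close> carries no meaning.\<close>

definition min_norm :: "nat \<Rightarrow> real vec set \<Rightarrow> real" where
  "min_norm n L = (LEAST r. \<exists>v \<in> L - {0\<^sub>v n}. r = vnorm v)"

definition min_vecs :: "nat \<Rightarrow> real vec set \<Rightarrow> real vec set" where
  "min_vecs n L = {v \<in> L - {0\<^sub>v n}. vnorm v = min_norm n L}"

definition generated_by_min_vecs :: "nat \<Rightarrow> real vec set \<Rightarrow> bool" where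
  "generated_by_min_vecs n L \<longleftrightarrow> L = generate (euclid n) (min_vecs n L)"

definition irreducible_lattice :: "nat \<Rightarrow> real vec set \<Rightarrow> bool" where
  "irreducible_lattice n L \<longleftrightarrow>
     \<not> (\<exists>M N. sublattice n M L \<and> sublattice n N L \<and> M \<noteq> {0\<^sub>v n} \<and> N \<noteq> {0\<^sub>v n} \<and>
          (\<forall>x\<in>M. \<forall>y\<in>N. x \<bullet> y = 0) \<and> L = M <#>\<^bsub>euclid n\<^esub> N)"

definition isometric :: "nat \<Rightarrow> real vec set \<Rightarrow> nat \<Rightarrow> real vec set \<Rightarrow> bool" where
  "isometric n L k M \<longleftrightarrow>
     (\<exists>f \<in> iso (euclid n\<lparr>carrier := L\<rparr>) (euclid k\<lparr>carrier := M\<rparr>).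
        \<forall>x\<in>L. \<forall>y\<in>L. f x \<bullet> f y = x \<bullet> y)"

definition integrable_lattice :: "nat \<Rightarrow> nat \<Rightarrow> real vec set \<Rightarrow> bool" where
  "integrable_lattice s n L \<longleftrightarrow>
     (\<exists>N>0. \<exists>M. sublattice N M (int_vecs N) \<and>
        isometric n ((\<lambda>v. sqrt (real s) \<cdot>\<^sub>v v) ` L) N M)"

end

theory Submission
  imports Defs "Jordan_Normal_Form.Determinant" "HOL-Number_Theory.Cong"
begin

text \<open>Construction A turns a self-dual ternary code of minimum weight 9 into a unimodular lattice
  of minimum norm 3 that contains \<open>sqrt 3\<close> times the standard frame, hence is 3-integrable. Its
  minimal vectors are the frame vectors and the codewords of weight 9.

  Let \<open>C\<close> be the self-dual ternary Pless code of length 24 and minimum weight 9, let \<open>u + v\<close> be a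
  codeword of weight 9, where \<open>u\<close> and \<open>v\<close> have disjoint supports of sizes 5 and 4, and let \<open>K\<close> be
  the subcode of \<open>C\<close> orthogonal to \<open>v\<close>. On \<open>m\<close> blocks of length 24, arranged cyclically, take the
  sum of the copies of \<open>K\<close> and of the glue words \<open>u\<^sub>i + v\<^sub>i\<^sub>+\<^sub>1\<close>. This code is again self-dual. A block
  of a word is either in \<open>C\<close>, and then zero or of weight at least 9, or it is a codeword minus
  \<open>c v\<close> with \<open>c \<noteq> 0\<close>, and then of weight at least 4. The coefficients \<open>c\<close> sum to zero around the
  cycle, so if one of them is nonzero then two are; the weight is then at least 8, and it is
  divisible by 3. The glue words connect neighbouring blocks, and a minimal vector cannot be split
  orthogonally, which gives irreducibility.\<close>

section \<open>Construction A for a systematic ternary code\<close>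

lemma m_inv_euclid:
  assumes "v \<in> carrier_vec n"
  shows "inv\<^bsub>euclid n\<^esub> v = - v"
proof -
  interpret comm_group "euclid n" by (rule comm_group_vec)
  show ?thesis
    by (rule inv_equality) (use assms in \<open>auto simp: monoid_vec_simps\<close>)
qed

lemma subgroup_euclidI:
  assumes "H \<subseteq> carrier_vec n" "0\<^sub>v n \<in> H"
    and "\<And>v w. v \<in> H \<Longrightarrow> w \<in> H \<Longrightarrow> v + w \<in> H" "\<And>v. v \<in> H \<Longrightarrow> - v \<in> H"
  shows "subgroup H (euclid n)"
  using assms by unfold_locales (auto simp: monoid_vec_simps m_inv_euclid subset_iff)

section \<open>Residues modulo 3 and their weight\<close>

definition nz :: "int \<Rightarrow> nat" where
  "nz z = (if 3 dvd z then 0 else 1)"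

text \<open>The balanced residue in -1, 0, 1: the shortest integer lift, whose square is its
  contribution to the Hamming weight.\<close>

definition red :: "int \<Rightarrow> int" where
  "red z = (z + 1) mod 3 - 1"

lemma nz_cong: "[x = y] (mod 3) \<Longrightarrow> nz x = nz y"
  by (simp add: nz_def cong_dvd_iff)

lemma cong_red: "[red z = z] (mod 3)"
  by (simp add: red_def cong_def mod_diff_left_eq)

lemma red_square: "(red z)\<^sup>2 = int (nz z)"
proof -
  have "red z = 0 \<and> 3 dvd z \<or> red z = 1 \<and> \<not> 3 dvd z \<or> red z = -1 \<and> \<not> 3 dvd z"
    unfolding red_def by presburger
  then show ?thesis by (auto simp: nz_def)
qed

lemma cong_nz_square: "[int (nz z) = z\<^sup>2] (mod 3)"
  by (metis cong_pow cong_red red_square)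

text \<open>Lets Hamming weights bound integer norms from below.\<close>

lemma nz_le_square: "int (nz z) \<le> z\<^sup>2"
proof (cases "z = 0")
  case False
  then have "1 \<le> z\<^sup>2"
    by (metis add_0 zero_less_power2 zless_imp_add1_zle)
  then show ?thesis by (simp add: nz_def)
qed (simp add: nz_def)

lemma sum_lessThan_add:
  fixes f :: "nat \<Rightarrow> 'a :: comm_monoid_add"
  shows "(\<Sum>t<n + k. f t) = (\<Sum>t<n. f t) + (\<Sum>s<k. f (n + s))"
  by (induction k) (simp_all add: add.assoc)

section \<open>Code and lattice attached to a parity matrix\<close>

locale ternary_construction =
  fixes n :: nat and P :: "nat \<Rightarrow> nat \<Rightarrow> int"
begin

text \<open>The code consists of the words \<open>x\<close> of length \<open>2n\<close> whose second half is, modulo 3, the image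
  of the first half under the parity map \<open>F\<close> with matrix \<open>P\<close>; \<open>G\<close> is the transpose of \<open>F\<close>.\<close>

definition F :: "(nat \<Rightarrow> int) \<Rightarrow> nat \<Rightarrow> int" where
  "F x s = (\<Sum>t<n. P s t * x t)"

definition G :: "(nat \<Rightarrow> int) \<Rightarrow> nat \<Rightarrow> int" where
  "G y t = (\<Sum>s<n. P s t * y s)"

definition code :: "(nat \<Rightarrow> int) set" where
  "code = {x. \<forall>s<n. [x (n + s) = F x s] (mod 3)}"

text \<open>The scaling of Construction A. Words are functions on all of \<open>nat\<close>; values
  from \<open>2n\<close> on are discarded here.\<close>

definition emb :: "(nat \<Rightarrow> int) \<Rightarrow> real vec" where
  "emb x = vec (n + n) (\<lambda>t. of_int (x t) / sqrt 3)"

definition L :: "real vec set" where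
  "L = emb ` code"

text \<open>The parity half is the integer \<open>F x\<close> itself, not a residue, so that
  \<open>enc\<close> is additive as a map of integer words.\<close>

definition enc :: "(nat \<Rightarrow> int) \<Rightarrow> nat \<Rightarrow> int" where
  "enc x t = (if t < n then x t else F x (t - n))"

text \<open>Embedded, this is \<open>c * sqrt 3\<close> times a standard basis vector.\<close>

definition frame :: "int \<Rightarrow> nat \<Rightarrow> nat \<Rightarrow> int" where
  "frame c s t = (if t = s then 3 * c else 0)"

definition wt :: "(nat \<Rightarrow> int) \<Rightarrow> nat" where
  "wt x = (\<Sum>t<n + n. nz (x t))"

lemma F_add: "F (\<lambda>t. x t + y t) s = F x s + F y s"
  by (simp add: F_def algebra_simps sum.distrib)

lemma F_cong:
  assumes "\<And>t. t < n \<Longrightarrow> [x t = y t] (mod 3)"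
  shows "[F x s = F y s] (mod 3)"
  unfolding F_def by (intro cong_sum cong_scalar_left) (use assms in auto)

lemma emb_carrier [simp]: "emb x \<in> carrier_vec (n + n)"
  by (simp add: emb_def)

lemma dim_emb [simp]: "dim_vec (emb x) = n + n"
  by (simp add: emb_def)

lemma emb_index: "t < n + n \<Longrightarrow> emb x $ t = of_int (x t) / sqrt 3"
  by (simp add: emb_def)

lemma emb_add: "emb x + emb y = emb (\<lambda>t. x t + y t)"
  by (auto simp: emb_def add_divide_distrib)

lemma emb_uminus: "- emb x = emb (\<lambda>t. - x t)"
  by (auto simp: emb_def)

lemma emb_eqI: "(\<And>t. t < n + n \<Longrightarrow> x t = y t) \<Longrightarrow> emb x = emb y"
  by (auto simp: emb_def)

lemma emb_eq_0_iff: "emb x = 0\<^sub>v (n + n) \<longleftrightarrow> (\<forall>t<n + n. x t = 0)"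
  by (auto simp: emb_def vec_eq_iff)

lemma emb_inner: "emb x \<bullet> emb y = of_int (\<Sum>t<n + n. x t * y t) / 3"
proof -
  have "emb x \<bullet> emb y = (\<Sum>t<n + n. of_int (x t) / sqrt 3 * (of_int (y t) / sqrt 3))"
    unfolding scalar_prod_def by (intro sum.cong) (auto simp: emb_index)
  also have "\<dots> = (\<Sum>t<n + n. of_int (x t * y t) / 3)"
    by (intro sum.cong) auto
  finally show ?thesis by (simp add: sum_divide_distrib)
qed

lemma emb_norm: "vnorm (emb x) = of_int (\<Sum>t<n + n. (x t)\<^sup>2) / 3"
  by (simp add: vnorm_def emb_inner power2_eq_square)

lemma code_add:
  assumes "x \<in> code" "y \<in> code"
  shows "(\<lambda>t. x t + y t) \<in> code"
  using assms by (auto simp: code_def F_add intro: cong_add)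

lemma F_uminus: "F (\<lambda>t. - x t) s = - F x s"
  by (simp add: F_def sum_negf)

lemma code_uminus: "x \<in> code \<Longrightarrow> (\<lambda>t. - x t) \<in> code"
  by (auto simp: code_def F_uminus cong_minus_minus_iff)

lemma code_cong:
  assumes "x \<in> code" "\<And>t. t < n + n \<Longrightarrow> [x t = y t] (mod 3)"
  shows "y \<in> code"
proof -
  have "[y (n + s) = F y s] (mod 3)" if "s < n" for s
  proof -
    have "[y (n + s) = x (n + s)] (mod 3)"
      using assms(2)[of "n + s"] that by (simp add: cong_sym)
    also have "[x (n + s) = F x s] (mod 3)" using assms(1) that by (simp add: code_def)
    also have "[F x s = F y s] (mod 3)" by (rule F_cong) (use assms(2) in auto)
    finally show ?thesis .
  qed
  then show ?thesis by (simp add: code_def)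
qed

lemma code_0: "(\<lambda>t. 0) \<in> code"
  by (simp add: code_def F_def)

lemma frame_in_code: "frame c s \<in> code"
  by (rule code_cong[OF code_0]) (auto simp: frame_def cong_def)

lemma enc_in_code: "enc x \<in> code"
proof -
  have "F (enc x) s = F x s" for s
    unfolding F_def by (intro sum.cong) (auto simp: enc_def)
  then show ?thesis by (simp add: code_def enc_def)
qed

lemma cong_enc:
  assumes "x \<in> code" "t < n + n"
  shows "[x t = enc x t] (mod 3)"
proof (cases "t < n")
  case False
  then show ?thesis
    using assms unfolding code_def enc_def by (auto dest: spec[of _ "t - n"])
qed (simp add: enc_def)

section \<open>Basis, integrability and self-duality of the lattice\<close>

lemma L_carrier: "L \<subseteq> carrier_vec (n + n)"
  by (auto simp: L_def)

lemma subgroup_L: "subgroup L (euclid (n + n))"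
proof (rule subgroup_euclidI[OF L_carrier])
  have "emb (\<lambda>t. 0) = 0\<^sub>v (n + n)" by (simp add: emb_eq_0_iff)
  then show "0\<^sub>v (n + n) \<in> L"
    unfolding L_def using code_0 by (metis image_eqI)
qed (auto simp: L_def emb_add emb_uminus code_add code_uminus)

lemma full_lattice_L: "full_lattice (n + n) L"
proof -
  \<comment> \<open>In blocks, \<open>b\<close> has the rows \<open>(I, 0)\<close> and
    \<open>(P, 3 I)\<close>: lower triangular with diagonal entries 1 and 3.\<close>
  define b where "b s t = (if s < n then (if s = t then 1 else 0)
      else if t < n then P (s - n) t else if s = t then 3 else (0::int))" for s t
  define A :: "real mat" where
    "A = mat (n + n) (n + n) (\<lambda>(s, t). of_int (b s t) / sqrt 3)"
  have A: "A \<in> carrier_mat (n + n) (n + n)" by (simp add: A_def)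
  have "det A = prod_list (diag_mat A)"
    by (rule det_lower_triangular[OF _ A]) (auto simp: A_def b_def)
  also have "\<dots> \<noteq> 0"
    by (auto simp: prod_list_zero_iff diag_mat_def A_def b_def split: if_splits)
  finally have inv: "invertible_mat A"
    using A det_non_zero_imp_unit[OF A, of "()"]
    by (auto simp: invertible_mat_def inverts_mat_def Units_def ring_mat_def)
  \<comment> \<open>\<open>T\<close> is the action of \<open>b\<close> on integer vectors, written
    with \<open>F\<close>.\<close>
  define T where "T z s = (if s < n then z s else F z (s - n) + 3 * z s)" for z s
  have b_sum: "(\<Sum>t<n + n. b s t * z t) = T z s" if "s < n + n" for z s
  proof (cases "s < n")
    case True
    then show ?thesis by (simp add: T_def b_def if_distrib[of "\<lambda>x. x * _"] sum.delta cong: if_cong)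
  next
    case False
    have "(\<Sum>t<n + n. b s t * z t) = (\<Sum>t<n. b s t * z t) + (\<Sum>t=n..<n + n. b s t * z t)"
      by (simp add: lessThan_atLeast0 sum.atLeastLessThan_concat)
    also have "(\<Sum>t<n. b s t * z t) = F z (s - n)"
      using False by (simp add: b_def F_def)
    also have "(\<Sum>t=n..<n + n. b s t * z t) = (\<Sum>t=n..<n + n. if s = t then 3 * z t else 0)"
      by (intro sum.cong) (use False in \<open>auto simp: b_def\<close>)
    also have "\<dots> = 3 * z s" using False that by simp
    finally show ?thesis using False by (simp add: T_def)
  qed
  have A_mult: "A *\<^sub>v vec (n + n) (\<lambda>t. of_int (z t)) = emb (T z)" for z
  proof (rule eq_vecI)
    fix s assume "s < dim_vec (emb (T z))"
    then have s: "s < n + n" by simp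
    have "(A *\<^sub>v vec (n + n) (\<lambda>t. of_int (z t))) $ s
        = (\<Sum>t<n + n. of_int (b s t) / sqrt 3 * of_int (z t))"
      using s by (simp add: A_def scalar_prod_def lessThan_atLeast0)
    also have "\<dots> = of_int (\<Sum>t<n + n. b s t * z t) / sqrt 3"
      by (simp add: sum_divide_distrib)
    also have "\<dots> = emb (T z) $ s"
      by (simp only: b_sum[OF s] emb_index[OF s])
    finally show "(A *\<^sub>v vec (n + n) (\<lambda>t. of_int (z t))) $ s = emb (T z) $ s" .
  qed (simp add: A_def)
  have "L = (\<lambda>z. A *\<^sub>v z) ` int_vecs (n + n)"
  proof (intro equalityI subsetI)
    fix v assume "v \<in> L"
    then obtain x where x: "x \<in> code" "v = emb x" by (auto simp: L_def)
    \<comment> \<open>The preimage under \<open>T\<close>: the parity half of a codeword differs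
      from \<open>F x\<close> by a multiple of 3, and the quotient is the coefficient.\<close>
    define z where "z t = (if t < n then x t else (x t - F x (t - n)) div 3)" for t
    have Fz: "F z = F x" by (simp add: F_def z_def fun_eq_iff)
    have "T z t = x t" if "t < n + n" for t
    proof (cases "t < n")
      case False
      with cong_enc[OF x(1) that] have "3 dvd x t - F x (t - n)"
        by (simp add: enc_def cong_iff_dvd_diff)
      then show ?thesis using False by (simp add: T_def Fz) (simp add: z_def)
    qed (simp add: T_def z_def)
    then have "v = A *\<^sub>v vec (n + n) (\<lambda>t. of_int (z t))"
      by (simp add: A_mult x(2) cong: emb_eqI)
    then show "v \<in> (\<lambda>z. A *\<^sub>v z) ` int_vecs (n + n)" by (auto simp: int_vecs_def)
  next
    fix v assume "v \<in> (\<lambda>z. A *\<^sub>v z) ` int_vecs (n + n)"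
    then obtain w where w: "w \<in> int_vecs (n + n)" "v = A *\<^sub>v w" by auto
    define z where "z t = \<lfloor>w $ t\<rfloor>" for t
    have "w = vec (n + n) (\<lambda>t. of_int (z t))"
      using w(1) by (auto simp: int_vecs_def z_def)
    then have v: "v = emb (T z)" using A_mult w(2) by simp
    have "T z \<in> code"
      by (rule code_cong[OF enc_in_code[of z]]) (auto simp: T_def enc_def cong_def)
    then show "v \<in> L" by (auto simp: L_def v)
  qed
  then show ?thesis using A inv by (auto simp: full_lattice_def)
qed

text \<open>Scaling by \<open>sqrt 3\<close> undoes the denominator of \<open>emb\<close>, so the
  scaled lattice already consists of integer vectors and the identity is the isometry.\<close>

lemma integrable_L:
  assumes "n > 0"
  shows "integrable_lattice 3 (n + n) L"
proof -
  let ?M = "(\<lambda>v. sqrt (real 3) \<cdot>\<^sub>v v) ` L"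
  have scale: "sqrt (real 3) \<cdot>\<^sub>v emb x = vec (n + n) (\<lambda>t. of_int (x t))" for x
    by (auto simp: emb_def)
  have "subgroup ?M (euclid (n + n))"
  proof (rule subgroup_euclidI)
    have "0\<^sub>v (n + n) \<in> L" using subgroup.one_closed[OF subgroup_L] by (simp add: monoid_vec_simps)
    moreover have "sqrt (real 3) \<cdot>\<^sub>v 0\<^sub>v (n + n) = 0\<^sub>v (n + n)" by auto
    ultimately show "0\<^sub>v (n + n) \<in> ?M" by (metis image_eqI)
    fix v assume "v \<in> ?M"
    then obtain a where a: "a \<in> L" "v = sqrt (real 3) \<cdot>\<^sub>v a" by auto
    have ac: "a \<in> carrier_vec (n + n)" using a L_carrier by auto
    have "- a \<in> L" using subgroup.m_inv_closed[OF subgroup_L a(1)] ac by (simp add: m_inv_euclid)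
    moreover have "- v = sqrt (real 3) \<cdot>\<^sub>v (- a)" using a by auto
    ultimately show "- v \<in> ?M" by blast
    fix w assume "w \<in> ?M"
    then obtain b where b: "b \<in> L" "w = sqrt (real 3) \<cdot>\<^sub>v b" by auto
    have bc: "b \<in> carrier_vec (n + n)" using b L_carrier by auto
    have "a + b \<in> L"
      using subgroup.m_closed[OF subgroup_L a(1) b(1)] by (simp add: monoid_vec_simps)
    moreover have "v + w = sqrt (real 3) \<cdot>\<^sub>v (a + b)"
      using a b ac bc by (simp add: smult_add_distrib_vec)
    ultimately show "v + w \<in> ?M" by blast
  qed (use L_carrier in auto)
  moreover have "?M \<subseteq> int_vecs (n + n)"
    unfolding L_def image_image scale int_vecs_def by auto
  ultimately have "sublattice (n + n) ?M (int_vecs (n + n))"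
    by (simp add: sublattice_def)
  moreover have "isometric (n + n) ?M (n + n) ?M"
    unfolding isometric_def
    by (rule bexI[of _ id]) (auto simp: iso_def hom_def)
  ultimately show ?thesis
    unfolding integrable_lattice_def using assms
    by (intro exI[of _ "n + n"] conjI exI[of _ ?M]) auto
qed

lemma emb_in_L: "x \<in> code \<Longrightarrow> emb x \<in> L"
  by (simp add: L_def)

text \<open>The parity map negates inner products modulo 3, so the two halves of the sum
  cancel.\<close>

lemma code_self_orthogonal:
  assumes isom: "\<And>x y. [(\<Sum>s<n. F x s * F y s) = - (\<Sum>t<n. x t * y t)] (mod 3)"
    and xy: "x \<in> code" "y \<in> code"
  shows "3 dvd (\<Sum>t<n + n. x t * y t)"
proof -
  have "(\<Sum>t<n + n. x t * y t) = (\<Sum>t<n. x t * y t) + (\<Sum>s<n. x (n + s) * y (n + s))"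
    by (rule sum_lessThan_add)
  also have "[\<dots> = (\<Sum>t<n. x t * y t) + (\<Sum>s<n. F x s * F y s)] (mod 3)"
    by (intro cong_add cong_refl cong_sum cong_mult) (use xy in \<open>auto simp: code_def\<close>)
  also have "[(\<Sum>t<n. x t * y t) + (\<Sum>s<n. F x s * F y s)
      = (\<Sum>t<n. x t * y t) + - (\<Sum>t<n. x t * y t)] (mod 3)"
    by (intro cong_add cong_refl isom)
  finally show ?thesis by (simp add: cong_0_iff)
qed

lemma L_subset_dual:
  assumes isom: "\<And>x y. [(\<Sum>s<n. F x s * F y s) = - (\<Sum>t<n. x t * y t)] (mod 3)"
  shows "L \<subseteq> dual_lattice (n + n) L"
proof -
  have "emb x \<bullet> emb y \<in> \<int>" if xy: "x \<in> code" "y \<in> code" for x y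
  proof -
    obtain k where "(\<Sum>t<n + n. x t * y t) = 3 * k"
      using code_self_orthogonal[OF isom xy] by (elim dvdE)
    then show ?thesis unfolding emb_inner by (simp del: of_int_sum)
  qed
  then show ?thesis by (auto simp: dual_lattice_def L_def)
qed

text \<open>Pairing with the frame shows that a dual vector is integral after scaling by
  \<open>sqrt 3\<close>. Pairing with encoded unit words forces its information half to be
  \<open>- G y\<close>, where \<open>y\<close> is its parity half. Applying \<open>F\<close> to that
  half gives back \<open>y\<close>, which is the code condition.\<close>

lemma dual_subset_L:
  assumes coisom: "\<And>y s. s < n \<Longrightarrow> [F (G y) s = - y s] (mod 3)"
  shows "dual_lattice (n + n) L \<subseteq> L"
proof
  fix v assume v: "v \<in> dual_lattice (n + n) L"
  then have vc: "v \<in> carrier_vec (n + n)" by (simp add: dual_lattice_def)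
  have int: "v \<bullet> emb x \<in> \<int>" if "x \<in> code" for x
    using v that by (auto simp: dual_lattice_def L_def)
  define z where "z t = \<lfloor>sqrt 3 * v $ t\<rfloor>" for t
  have "v = emb z"
  proof (rule eq_vecI)
    fix t assume "t < dim_vec (emb z)"
    then have t: "t < n + n" by simp
    have "v \<bullet> emb (frame 1 t) = (\<Sum>s<n + n. if s = t then v $ s * (3 / sqrt 3) else 0)"
      unfolding scalar_prod_def by (intro sum.cong) (auto simp: emb_index frame_def)
    also have "\<dots> = sqrt 3 * v $ t"
      using t real_div_sqrt[of 3] by (simp add: mult.commute)
    finally have "sqrt 3 * v $ t \<in> \<int>" using int[OF frame_in_code] by metis
    then have "sqrt 3 * v $ t = of_int (z t)" by (simp add: z_def)
    then have "v $ t = of_int (z t) / sqrt 3" by (simp add: field_simps)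
    then show "v $ t = emb z $ t" using t by (simp add: emb_index)
  qed (use vc in simp)
  define y where "y s = z (n + s)" for s
  have info: "[z t = - G y t] (mod 3)" if t: "t < n" for t
  proof -
    define u :: "nat \<Rightarrow> int" where "u s = (if s = t then 1 else 0)" for s
    have "v \<bullet> emb (enc u) \<in> \<int>" by (intro int enc_in_code)
    then have "of_int (\<Sum>s<n + n. z s * enc u s) / (3::real) \<in> \<int>"
      by (simp add: \<open>v = emb z\<close> emb_inner)
    then obtain k where "of_int (\<Sum>s<n + n. z s * enc u s) / (3::real) = of_int k"
      by (auto elim: Ints_cases)
    then have "real_of_int (\<Sum>s<n + n. z s * enc u s) = of_int (3 * k)" by simp
    then have "3 dvd (\<Sum>s<n + n. z s * enc u s)" by (metis dvd_triv_left of_int_eq_iff)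
    moreover have "(\<Sum>s<n + n. z s * enc u s)
        = (\<Sum>s<n. z s * u s) + (\<Sum>s<n. z (n + s) * F u s)"
      by (subst sum_lessThan_add) (simp add: enc_def)
    moreover have "(\<Sum>s<n. z s * u s) = z t"
      using t by (simp add: u_def if_distrib[of "(*) _"] sum.delta cong: if_cong)
    moreover have "F u s = P s t" for s
      using t by (simp add: F_def u_def if_distrib[of "(*) _"] sum.delta cong: if_cong)
    moreover have "(\<Sum>s<n. z (n + s) * P s t) = G y t"
      by (simp add: G_def y_def mult.commute)
    ultimately have "3 dvd z t + G y t" by simp
    then show ?thesis by (simp add: cong_iff_dvd_diff)
  qed
  have "[z (n + s) = F z s] (mod 3)" if s: "s < n" for s
  proof -
    have "[F z s = F (\<lambda>t. - G y t) s] (mod 3)" by (rule F_cong) (rule info)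
    also have "F (\<lambda>t. - G y t) s = - F (G y) s" by (rule F_uminus)
    also have "[\<dots> = - (- y s)] (mod 3)"
      using coisom[OF s, of y] by (simp only: cong_minus_minus_iff)
    finally show ?thesis by (simp add: y_def cong_sym)
  qed
  then show "v \<in> L" by (auto simp: \<open>v = emb z\<close> L_def code_def)
qed

lemma vnorm_frame: "t < n + n \<Longrightarrow> vnorm (emb (frame c t)) = 3 * of_int (c\<^sup>2)"
  by (simp add: emb_norm frame_def if_distrib[of "\<lambda>x. x\<^sup>2"] power_mult_distrib cong: if_cong)

end

text \<open>The bound concerns integer words and not weights, so that it also covers nonzero words
  that vanish modulo 3.\<close>

locale ternary_construction_min_3 = ternary_construction +
  assumes n_pos: "n > 0"
    and norm_ge_9: "x \<in> code \<Longrightarrow> t < n + n \<Longrightarrow> x t \<noteq> 0 \<Longrightarrow> 9 \<le> (\<Sum>s<n + n. (x s)\<^sup>2)"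
begin

abbreviation "min_L \<equiv> min_vecs (n + n) L"
abbreviation "Span \<equiv> generate (euclid (n + n)) min_L"

section \<open>Minimal vectors of norm 3\<close>

lemma vnorm_ge_3:
  assumes "v \<in> L" "v \<noteq> 0\<^sub>v (n + n)"
  shows "3 \<le> vnorm v"
proof -
  obtain x t where "x \<in> code" "v = emb x" "t < n + n" "x t \<noteq> 0"
    using assms by (auto simp: L_def emb_eq_0_iff)
  then have "9 \<le> (\<Sum>s<n + n. (x s)\<^sup>2)" using norm_ge_9 by blast
  then have "9 \<le> real_of_int (\<Sum>s<n + n. (x s)\<^sup>2)" by linarith
  then show ?thesis by (simp add: \<open>v = emb x\<close> emb_norm)
qed

lemma vnorm_0: "vnorm (0\<^sub>v k) = 0"
  by (simp add: vnorm_def)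

lemma min_norm_L: "min_norm (n + n) L = 3"
  unfolding min_norm_def
proof (rule Least_equality)
  have "vnorm (emb (frame 1 0)) = 3" using vnorm_frame[of 0 1] n_pos by simp
  moreover from this have "emb (frame 1 0) \<noteq> 0\<^sub>v (n + n)" by (auto simp: vnorm_0)
  ultimately show "\<exists>v\<in>L - {0\<^sub>v (n + n)}. 3 = vnorm v"
    using frame_in_code by (auto simp: L_def)
qed (use vnorm_ge_3 in auto)

lemma min_vecs_L: "min_L = {v \<in> L. vnorm v = 3}"
  by (auto simp: min_vecs_def min_norm_L vnorm_0)

lemma frame_min:
  assumes "t < n + n" "c = 1 \<or> c = -1"
  shows "emb (frame c t) \<in> min_L"
  using assms vnorm_frame[of t c] frame_in_code by (auto simp: min_vecs_L emb_in_L)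

lemma red_min:
  assumes "x \<in> code" "wt x = 9"
  shows "emb (\<lambda>t. red (x t)) \<in> min_L"
proof -
  have "(\<lambda>t. red (x t)) \<in> code"
    by (rule code_cong[OF assms(1)]) (simp add: cong_red cong_sym)
  moreover have "(\<Sum>t<n + n. (red (x t))\<^sup>2) = 9"
    using assms(2) by (simp add: red_square wt_def flip: of_nat_sum)
  ultimately show ?thesis by (simp add: min_vecs_L emb_in_L emb_norm del: of_int_sum)
qed

lemma odd_unimodular_L:
  assumes "\<And>x y. [(\<Sum>s<n. F x s * F y s) = - (\<Sum>t<n. x t * y t)] (mod 3)"
    and "\<And>y s. s < n \<Longrightarrow> [F (G y) s = - y s] (mod 3)"
  shows "odd_unimodular (n + n) L"
proof -
  have "L = dual_lattice (n + n) L"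
    using L_subset_dual[OF assms(1)] dual_subset_L[OF assms(2)] by blast
  \<comment> \<open>A frame vector has norm 3 and so witnesses oddness.\<close>
  moreover have "emb (frame 1 0) \<in> L" "vnorm (emb (frame 1 0)) = of_int 3"
    using frame_min[of 0 1] n_pos by (auto simp: min_vecs_L)
  moreover have "odd (3::int)" by simp
  ultimately show ?thesis
    unfolding odd_unimodular_def unimodular_def using full_lattice_L by blast
qed

section \<open>Generation by the minimal vectors\<close>

definition gen_code :: "(nat \<Rightarrow> int) set" where
  "gen_code = {x. emb x \<in> Span}"

lemma gen_code_add:
  assumes "x \<in> gen_code" "y \<in> gen_code"
  shows "(\<lambda>t. x t + y t) \<in> gen_code"
  using generate.eng[of "emb x" "euclid (n + n)" min_L "emb y"] assms
  by (simp add: gen_code_def monoid_vec_simps emb_add)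

lemma gen_code_cong_eq:
  assumes "x \<in> gen_code" "\<And>t. t < n + n \<Longrightarrow> x t = y t"
  shows "y \<in> gen_code"
  using assms emb_eqI[of x y] by (simp add: gen_code_def)

lemma gen_code_0: "(\<lambda>t. 0) \<in> gen_code"
proof -
  have "emb (\<lambda>t. 0) = \<one>\<^bsub>euclid (n + n)\<^esub>" by (simp add: monoid_vec_simps emb_eq_0_iff)
  then show ?thesis by (simp add: gen_code_def generate.one)
qed

lemma gen_code_scale:
  assumes "x \<in> gen_code"
  shows "(\<lambda>t. int k * x t) \<in> gen_code"
proof (induction k)
  case (Suc k)
  show ?case
    by (rule gen_code_cong_eq[OF gen_code_add[OF assms Suc]]) (simp add: algebra_simps)
qed (simp add: gen_code_0)

lemma gen_code_sum:
  assumes "finite A" "\<And>a. a \<in> A \<Longrightarrow> f a \<in> gen_code"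
  shows "(\<lambda>t. \<Sum>a\<in>A. f a t) \<in> gen_code"
  using assms by (induction A rule: finite_induct) (auto simp: gen_code_0 gen_code_add)

lemma gen_code_frame:
  assumes "s < n + n"
  shows "frame c s \<in> gen_code"
proof -
  \<comment> \<open>\<open>gen_code_scale\<close> treats natural multiples, so the sign of
    \<open>c\<close> goes into the frame vector.\<close>
  define e :: int where "e = (if c < 0 then -1 else 1)"
  have "frame e s \<in> gen_code"
    using frame_min[OF assms, of e] by (auto simp: gen_code_def e_def intro: generate.incl)
  from gen_code_scale[OF this, of "nat \<bar>c\<bar>"] show ?thesis
    by (rule gen_code_cong_eq) (auto simp: frame_def e_def)
qed

text \<open>The frame words generate all words divisible by 3, so membership depends only on
  residues.\<close>

lemma gen_code_cong:
  assumes "x \<in> gen_code" "\<And>t. t < n + n \<Longrightarrow> [x t = y t] (mod 3)"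
  shows "y \<in> gen_code"
proof -
  define d where "d t = (y t - x t) div 3" for t
  have d: "x t + 3 * d t = y t" if "t < n + n" for t
  proof -
    have "3 dvd y t - x t"
      using assms(2)[OF that] by (metis cong_iff_dvd_diff cong_sym)
    then show ?thesis by (simp add: d_def)
  qed
  have "(\<lambda>t. x t + (\<Sum>s<n + n. frame (d s) s t)) \<in> gen_code"
    by (intro gen_code_add assms(1) gen_code_sum gen_code_frame) auto
  then show ?thesis
    by (rule gen_code_cong_eq) (simp add: frame_def d)
qed

lemma gen_code_weight_9: "x \<in> code \<Longrightarrow> wt x = 9 \<Longrightarrow> x \<in> gen_code"
  by (rule gen_code_cong[of "\<lambda>t. red (x t)"])
    (auto simp: gen_code_def cong_red intro: generate.incl red_min)

text \<open>A codeword is determined modulo 3 by its information half, so generation can be tested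
  on information words of length \<open>n\<close>.\<close>

definition gen_info :: "(nat \<Rightarrow> int) set" where
  "gen_info = {p. enc p \<in> gen_code}"

lemma enc_add: "enc (\<lambda>t. p t + q t) = (\<lambda>t. enc p t + enc q t)"
  by (auto simp: enc_def F_add)

lemma gen_info_add: "p \<in> gen_info \<Longrightarrow> q \<in> gen_info \<Longrightarrow> (\<lambda>t. p t + q t) \<in> gen_info"
  by (simp add: gen_info_def enc_add gen_code_add)

lemma gen_info_cong:
  assumes "p \<in> gen_info" "\<And>t. t < n \<Longrightarrow> [p t = q t] (mod 3)"
  shows "q \<in> gen_info"
proof -
  have "enc q \<in> gen_code"
  proof (rule gen_code_cong)
    show "[enc p t = enc q t] (mod 3)" for t
      using assms(2) F_cong[of p q] by (auto simp: enc_def)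
  qed (use assms(1) in \<open>simp add: gen_info_def\<close>)
  then show ?thesis by (simp add: gen_info_def)
qed

lemma gen_info_0: "(\<lambda>t. 0) \<in> gen_info"
proof -
  have "enc (\<lambda>t. 0) = (\<lambda>t. 0)" by (auto simp: enc_def F_def)
  then show ?thesis by (simp add: gen_info_def gen_code_0)
qed

lemma gen_info_scale:
  assumes "p \<in> gen_info"
  shows "(\<lambda>t. c * p t) \<in> gen_info"
proof -
  have nat: "(\<lambda>t. int k * p t) \<in> gen_info" for k
  proof (induction k)
    case (Suc k)
    show ?case using gen_info_add[OF assms Suc] by (simp add: algebra_simps)
  qed (simp add: gen_info_0)
  show ?thesis
  proof (rule gen_info_cong[OF nat[of "nat (c mod 3)"]])
    show "[int (nat (c mod 3)) * p t = c * p t] (mod 3)" for t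
      by (intro cong_mult) auto
  qed
qed

lemma gen_info_sum:
  assumes "finite A" "\<And>a. a \<in> A \<Longrightarrow> f a \<in> gen_info"
  shows "(\<lambda>t. \<Sum>a\<in>A. f a t) \<in> gen_info"
  using assms by (induction A rule: finite_induct) (auto simp: gen_info_0 gen_info_add)

lemma gen_info_weight_9: "wt (enc p) = 9 \<Longrightarrow> p \<in> gen_info"
  by (simp add: gen_info_def gen_code_weight_9 enc_in_code)

text \<open>The information half of a codeword is an integral combination of unit words, and the
  codeword is congruent to its encoding.\<close>

lemma generated_L:
  assumes unit: "\<And>s. s < n \<Longrightarrow> (\<lambda>t. if t = s then 1 else 0) \<in> gen_info"
  shows "generated_by_min_vecs (n + n) L"
  unfolding generated_by_min_vecs_def
proof
  have "min_L \<subseteq> L" by (auto simp: min_vecs_L)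
  then show "Span \<subseteq> L"
    by (rule group.generate_subgroup_incl[OF comm_group.axioms(2)[OF comm_group_vec] _ subgroup_L])
  show "L \<subseteq> Span"
  proof
    fix v assume "v \<in> L"
    then obtain x where x: "x \<in> code" "v = emb x" by (auto simp: L_def)
    have "(\<lambda>t. \<Sum>s<n. x s * (if t = s then 1 else 0)) \<in> gen_info"
      by (intro gen_info_sum gen_info_scale unit) auto
    then have "x \<in> gen_info"
      by (rule gen_info_cong)
        (simp add: if_distrib[of "(*) _"] sum.delta' cong: if_cong)
    then have "enc x \<in> gen_code" by (simp add: gen_info_def)
    then have "x \<in> gen_code"
      by (rule gen_code_cong) (simp add: cong_enc[OF x(1)] cong_sym)
    then show "v \<in> Span" by (simp add: gen_code_def x(2))
  qed
qed

text \<open>The hypothesis says that a two-colouring of the coordinates is constant once it is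
  constant on the support of each word of weight 9. It is applied to the colouring by the summand
  that contains the frame vector.\<close>

lemma irreducible_L:
  assumes connected: "\<And>\<sigma> :: nat \<Rightarrow> bool. \<lbrakk>\<And>x s t. \<lbrakk>x \<in> code; wt x = 9; s < n + n; t < n + n;
      \<not> 3 dvd x s; \<not> 3 dvd x t\<rbrakk> \<Longrightarrow> \<sigma> s = \<sigma> t\<rbrakk> \<Longrightarrow> \<forall>s<n + n. \<forall>t<n + n. \<sigma> s = \<sigma> t"
  shows "irreducible_lattice (n + n) L"
  unfolding irreducible_lattice_def
proof (rule notI, elim exE conjE)
  fix M N
  assume M: "sublattice (n + n) M L" and N: "sublattice (n + n) N L"
    and M0: "M \<noteq> {0\<^sub>v (n + n)}" and N0: "N \<noteq> {0\<^sub>v (n + n)}"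
    and orth: "\<forall>x\<in>M. \<forall>y\<in>N. x \<bullet> y = 0" and sum: "L = M <#>\<^bsub>euclid (n + n)\<^esub> N"
  have zero: "0\<^sub>v (n + n) \<in> M" "0\<^sub>v (n + n) \<in> N"
    using subgroup.one_closed M N by (fastforce simp: sublattice_def monoid_vec_simps)+
  have sub: "M \<subseteq> L" "N \<subseteq> L" using M N by (auto simp: sublattice_def)
  have split: "w \<in> M \<or> w \<in> N" if w: "w \<in> min_L" for w
  proof -
    from w have "w \<in> L" "vnorm w = 3" by (auto simp: min_vecs_L)
    then obtain a b where ab: "a \<in> M" "b \<in> N" "w = a + b"
      unfolding sum set_mult_def by (auto simp: monoid_vec_simps)
    have c: "a \<in> carrier_vec (n + n)" "b \<in> carrier_vec (n + n)"
      using ab sub L_carrier by auto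
    have "a \<bullet> b = 0" using orth ab by blast
    then have "vnorm w = vnorm a + vnorm b"
      using c by (simp add: vnorm_def ab(3) add_scalar_prod_distrib[of _ "n + n"]
          scalar_prod_add_distrib[of _ "n + n"] comm_scalar_prod[of b "n + n" a])
    \<comment> \<open>Two nonzero parts would have total norm at least 6.\<close>
    then have "a = 0\<^sub>v (n + n) \<or> b = 0\<^sub>v (n + n)"
      using vnorm_ge_3[of a] vnorm_ge_3[of b] ab sub \<open>vnorm w = 3\<close> by fastforce
    then show ?thesis using ab c by auto
  qed
  have inner_frame: "emb x \<bullet> emb (frame 1 t) = of_int (x t)" if "t < n + n" for x t
    using that by (simp add: emb_inner frame_def if_distrib[of "(*) _"] sum.delta cong: if_cong)
  define \<sigma> where "\<sigma> t \<longleftrightarrow> emb (frame 1 t) \<in> M" for t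
  have frame_N: "emb (frame 1 t) \<in> N" if "t < n + n" "\<not> \<sigma> t" for t
    using split[OF frame_min[of t 1]] that by (auto simp: \<sigma>_def)
  \<comment> \<open>The inner product of \<open>emb x\<close> with a frame vector is an entry of
    \<open>x\<close>, so a minimal vector lies in the same summand as each frame vector of its
    support.\<close>
  have side: "emb x \<in> M \<longleftrightarrow> \<sigma> t" if "emb x \<in> min_L" "t < n + n" "x t \<noteq> 0" for x t
  proof -
    have "emb x \<bullet> emb (frame 1 t) \<noteq> 0"
      using that inner_frame[of t x] by simp
    moreover from this have "emb (frame 1 t) \<bullet> emb x \<noteq> 0"
      by (subst comm_scalar_prod[OF emb_carrier emb_carrier])
    ultimately show ?thesis
      using split[OF that(1)] frame_N[OF that(2)] orth unfolding \<sigma>_def by blast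
  qed
  have "\<sigma> s = \<sigma> t" if "x \<in> code" "wt x = 9" "s < n + n" "t < n + n" "\<not> 3 dvd x s" "\<not> 3 dvd x t"
    for x s t
  proof -
    have "red (x r) \<noteq> 0" if "\<not> 3 dvd x r" for r
      using that red_square[of "x r"] by (auto simp: nz_def)
    then have "red (x s) \<noteq> 0" "red (x t) \<noteq> 0" using that by blast+
    then show ?thesis
      using side[OF red_min[OF that(1,2)] that(3)] side[OF red_min[OF that(1,2)] that(4)] by blast
  qed
  then have const: "\<forall>s<n + n. \<forall>t<n + n. \<sigma> s = \<sigma> t" by (rule connected)
  \<comment> \<open>A lattice vector orthogonal to the whole frame has only zero entries; this kills
    the summand that contains no frame vector.\<close>
  have trivial: "K = {0\<^sub>v (n + n)}"
    if K: "K \<subseteq> L" "0\<^sub>v (n + n) \<in> K"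
      and orthK: "\<And>y t. y \<in> K \<Longrightarrow> t < n + n \<Longrightarrow> y \<bullet> emb (frame 1 t) = 0" for K
  proof -
    have "y = 0\<^sub>v (n + n)" if y: "y \<in> K" for y
    proof -
      obtain x where x: "y = emb x" using y K by (auto simp: L_def)
      have "x t = 0" if "t < n + n" for t
        using orthK[OF y that] inner_frame[OF that, of x] by (simp add: x)
      then show ?thesis by (simp add: x emb_eq_0_iff)
    qed
    then show ?thesis using K(2) by blast
  qed
  show False
  proof (cases "\<sigma> 0")
    case True
    then have "emb (frame 1 t) \<in> M" if "t < n + n" for t
      using const[rule_format, of 0 t] n_pos that True by (simp add: \<sigma>_def)
    then have "y \<bullet> emb (frame 1 t) = 0" if "y \<in> N" "t < n + n" for y t
      using orth that sub L_carrier comm_scalar_prod[OF _ emb_carrier, of y "frame 1 t"]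
      by (metis subsetD)
    then have "N = {0\<^sub>v (n + n)}"
      using sub by (intro trivial zero) auto
    then show False using N0 by simp
  next
    case False
    then have "emb (frame 1 t) \<in> N" if "t < n + n" for t
      using const[rule_format, of 0 t] n_pos that False frame_N by simp
    then have "M = {0\<^sub>v (n + n)}"
      using orth sub by (intro trivial zero) auto
    then show False using M0 by simp
  qed
qed

end

section \<open>The code of length 24\<close>

text \<open>The symmetric conference matrix with border 1 and core \<open>\<chi>(i + j)\<close>, \<open>\<chi>\<close> the quadratic
  character modulo 11, after a signed permutation applied to rows and columns alike. The permutation
  moves to the front five rows whose sum has exactly four entries that are nonzero modulo 3: the
  word \<open>u\<close> is \<open>lam\<close> in the information half, and \<open>v\<close> is \<open>- glue\<close> in the parity half.\<close>

definition X_rows :: "int list list" where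
  "X_rows =
   [[0, 1, -1, 1, -1, 1, -1, -1, -1, 1, -1, 1],
    [1, -1, 1, 1, 1, 1, -1, -1, 1, -1, 0, 1],
    [-1, 1, 1, 1, 1, -1, -1, 1, -1, 0, 1, 1],
    [1, 1, 1, -1, 1, -1, 1, -1, 0, 1, -1, 1],
    [-1, 1, 1, 1, -1, -1, 0, -1, 1, -1, -1, -1],
    [1, 1, -1, -1, -1, -1, -1, 0, 1, -1, 1, 1],
    [-1, -1, -1, 1, 0, -1, 1, -1, 1, 1, 1, 1],
    [-1, -1, 1, -1, -1, 0, -1, 1, 1, 1, -1, 1],
    [-1, 1, -1, 0, 1, 1, 1, 1, 1, -1, -1, 1],
    [1, -1, 0, 1, -1, -1, 1, 1, -1, -1, -1, 1],
    [-1, 0, 1, -1, -1, 1, 1, -1, -1, -1, 1, 1],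
    [1, 1, 1, 1, -1, 1, 1, 1, 1, 1, 1, 0]]"

definition X :: "nat \<Rightarrow> nat \<Rightarrow> int" where
  "X j l = X_rows ! j ! l"

definition lam :: "nat \<Rightarrow> int" where
  "lam j = (if j < 5 then 1 else 0)"

definition Xm :: "(nat \<Rightarrow> int) \<Rightarrow> nat \<Rightarrow> int" where
  "Xm a l = (\<Sum>j<12. X l j * a j)"

definition glue :: "nat \<Rightarrow> int" where
  "glue l = - Xm lam l"

definition wt12 :: "(nat \<Rightarrow> int) \<Rightarrow> nat" where
  "wt12 a = (\<Sum>j<12. nz (a j))"

section \<open>Finite checks on the matrix \<open>X\<close>\<close>

lemma X_sym': "\<forall>j<12. \<forall>l<12. X j l = X l j"
  by code_simp

text \<open>As 11 is -1 modulo 3, this is the source of self-duality. The sum is a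
  \<open>sum_list\<close> so that evaluation decides it.\<close>

lemma X_square': "\<forall>j<12. \<forall>l<12. sum_list (map (\<lambda>k. X j k * X k l) [0..<12]) = (if j = l then 11 else 0)"
  by code_simp

lemma wt_glue': "sum_list (map (\<lambda>l. nz (- sum_list (map (X l) [0..<5]))) [0..<12]) = 4"
  by code_simp

text \<open>Distinct columns have their zeros in different places and, being orthogonal, agree in 5
  of the other 10 places and are opposite in 5; hence 5 + 2.\<close>

lemma wt_pair': "\<forall>j<12. \<forall>k<12. j \<noteq> k \<longrightarrow>
    sum_list (map (\<lambda>l. nz (X l j + X l k)) [0..<12]) = 7 \<and>
    sum_list (map (\<lambda>l. nz (X l j - X l k)) [0..<12]) = 7"
  by code_simp

lemma wt_single': "\<forall>j<12. sum_list (map (\<lambda>l. nz (X l j)) [0..<12]) = 11"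
  by code_simp

text \<open>For connectedness: at each parity place some difference of two of the first five columns
  is nonzero modulo 3.\<close>

lemma X_nonconst: "\<forall>l<12. \<exists>j<5. \<exists>k<5. \<not> 3 dvd X l j - X l k"
  by code_simp


lemma sum_list_12: "sum_list (map f [0..<12]) = (\<Sum>l<12. f l)"
  by (simp only: interv_sum_list_conv_sum_set_nat lessThan_atLeast0 set_upt)

lemma X_sym: "j < 12 \<Longrightarrow> l < 12 \<Longrightarrow> X j l = X l j"
  using X_sym' by blast

lemma X_square: "j < 12 \<Longrightarrow> l < 12 \<Longrightarrow> (\<Sum>k<12. X j k * X k l) = (if j = l then 11 else 0)"
  using X_square' unfolding sum_list_12 by blast

lemma wt_single: "j < 12 \<Longrightarrow> (\<Sum>l<12. nz (X l j)) = 11"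
  using wt_single' unfolding sum_list_12 by blast

lemma wt_sum: "j < 12 \<Longrightarrow> k < 12 \<Longrightarrow> j \<noteq> k \<Longrightarrow> (\<Sum>l<12. nz (X l j + X l k)) = 7"
  using wt_pair' unfolding sum_list_12 by blast

lemma wt_diff: "j < 12 \<Longrightarrow> k < 12 \<Longrightarrow> j \<noteq> k \<Longrightarrow> (\<Sum>l<12. nz (X l j - X l k)) = 7"
  using wt_pair' unfolding sum_list_12 by blast

lemma Xm_lam: "Xm lam l = (\<Sum>j<5. X l j)"
proof -
  have "Xm lam l = (\<Sum>j<12. if j < 5 then X l j else 0)"
    unfolding Xm_def by (intro sum.cong) (auto simp: lam_def)
  also have "\<dots> = (\<Sum>j\<in>{j \<in> {..<12}. j < 5}. X l j)"
    by (rule sum.inter_filter[symmetric]) simp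
  also have "{j \<in> {..<12}. j < 5} = {..<5::nat}" by auto
  finally show ?thesis .
qed

lemma wt_glue: "wt12 glue = 4"
proof -
  have "sum_list (map (X l) [0..<5]) = Xm lam l" for l
    by (simp only: Xm_lam interv_sum_list_conv_sum_set_nat lessThan_atLeast0 set_upt)
  then show ?thesis using wt_glue' unfolding wt12_def glue_def sum_list_12 by simp
qed

lemma wt_lam: "wt12 lam = 5"
  by (simp add: wt12_def lam_def nz_def eval_nat_numeral)

section \<open>Inner products under the symmetric map \<open>Xm\<close>\<close>

lemma Xm_adjoint: "(\<Sum>l<12. Xm a l * b l) = (\<Sum>l<12. a l * Xm b l)"
proof -
  have "(\<Sum>l<12. Xm a l * b l) = (\<Sum>l<12. \<Sum>j<12. X l j * a j * b l)"
    by (simp add: Xm_def sum_distrib_right)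
  also have "\<dots> = (\<Sum>j<12. \<Sum>l<12. X l j * a j * b l)" by (rule sum.swap)
  also have "\<dots> = (\<Sum>j<12. \<Sum>l<12. a j * (X j l * b l))"
    by (intro sum.cong refl) (use X_sym in auto)
  finally show ?thesis by (simp add: Xm_def sum_distrib_left)
qed

lemma Xm_Xm: "l < 12 \<Longrightarrow> Xm (Xm a) l = 11 * a l"
proof -
  assume l: "l < 12"
  have "Xm (Xm a) l = (\<Sum>j<12. \<Sum>k<12. X l j * X j k * a k)"
    by (simp add: Xm_def sum_distrib_left mult.assoc)
  also have "\<dots> = (\<Sum>k<12. (\<Sum>j<12. X l j * X j k) * a k)"
    by (subst sum.swap) (simp add: sum_distrib_right)
  also have "\<dots> = (\<Sum>k<12. if l = k then 11 * a k else 0)"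
    by (intro sum.cong refl) (use X_square l in auto)
  finally show ?thesis using l by simp
qed

lemma Xm_add: "Xm (\<lambda>j. a j + b j) l = Xm a l + Xm b l"
  by (simp add: Xm_def algebra_simps sum.distrib)

lemma Xm_mult: "Xm (\<lambda>j. c * a j) l = c * Xm a l"
  by (simp add: Xm_def algebra_simps sum_distrib_left)

lemma Xm_cong: "(\<And>j. j < 12 \<Longrightarrow> a j = b j) \<Longrightarrow> Xm a l = Xm b l"
  by (simp add: Xm_def)

lemma Xm_cong_mod:
  assumes "\<And>j. j < 12 \<Longrightarrow> [a j = b j] (mod 3)"
  shows "[Xm a l = Xm b l] (mod 3)"
  unfolding Xm_def by (intro cong_sum cong_scalar_left) (use assms in auto)

lemma Xm_glue: "l < 12 \<Longrightarrow> Xm glue l = - 11 * lam l"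
  using Xm_Xm[of l lam] Xm_mult[of "-1" "Xm lam" l] by (simp add: glue_def[abs_def])

lemma sum_lam_lam: "(\<Sum>l<12. lam l * lam l) = 5"
  by (simp add: lam_def eval_nat_numeral)

lemma sum_Xm_glue: "(\<Sum>l<12. Xm a l * glue l) = - 11 * (\<Sum>l<12. lam l * a l)"
  unfolding Xm_adjoint sum_distrib_left by (intro sum.cong refl) (simp add: Xm_glue)

lemma sum_glue_glue: "(\<Sum>l<12. glue l * glue l) = 55"
proof -
  have "(\<Sum>l<12. glue l * glue l) = - (\<Sum>l<12. Xm lam l * glue l)"
    by (subst (1) glue_def) (simp add: sum_negf)
  then show ?thesis by (simp add: sum_Xm_glue sum_lam_lam)
qed

section \<open>Weights and norms in one block\<close>

lemma nz_mult: "\<not> 3 dvd c \<Longrightarrow> nz (c * x) = nz x"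
  by (simp add: nz_def prime_dvd_mult_iff)

text \<open>Modulo 3, \<open>d\<close> is \<open>c\<close> or \<open>- c\<close>, so up to the unit
  \<open>c\<close> the combination is a sum or a difference of two columns.\<close>

lemma wt_pair:
  assumes jk: "j < 12" "k < 12" "j \<noteq> k" and cd: "\<not> 3 dvd c" "\<not> 3 dvd d"
  shows "(\<Sum>l<12. nz (X l j * c + X l k * d)) = 7"
proof -
  have "3 dvd c - d \<or> 3 dvd c + d" using cd by presburger
  then show ?thesis
  proof
    assume "3 dvd c - d"
    then have "[d = c] (mod 3)" by (simp add: cong_iff_dvd_diff dvd_diff_commute)
    then have "[X l j * c + X l k * d = X l j * c + X l k * c] (mod 3)" for l
      by (intro cong_add cong_mult cong_refl)
    then have "nz (X l j * c + X l k * d) = nz (X l j + X l k)" for l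
      using nz_cong nz_mult[OF cd(1), of "X l j + X l k"] by (metis distrib_left mult.commute)
    then show ?thesis using wt_sum[OF jk] by simp
  next
    assume "3 dvd c + d"
    then have "[d = - c] (mod 3)" by (simp add: cong_iff_dvd_diff add.commute)
    then have "[X l j * c + X l k * d = X l j * c + X l k * (- c)] (mod 3)" for l
      by (intro cong_add cong_mult cong_refl)
    moreover have "X l j * c + X l k * (- c) = c * (X l j - X l k)" for l
      by (simp add: algebra_simps)
    ultimately have "nz (X l j * c + X l k * d) = nz (X l j - X l k)" for l
      using nz_cong nz_mult[OF cd(1), of "X l j - X l k"] by metis
    then show ?thesis using wt_diff[OF jk] by simp
  qed
qed

lemma nz_triangle: "nz y \<le> nz (x + y) + nz x"
  by (auto simp: nz_def) presburger

lemma nz_eq_0_iff: "nz z = 0 \<longleftrightarrow> 3 dvd z"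
  by (simp add: nz_def)

lemma wt12_eq_0_iff: "wt12 a = 0 \<longleftrightarrow> (\<forall>j<12. 3 dvd a j)"
  by (auto simp: wt12_def nz_eq_0_iff)

lemma wt12_card: "wt12 a = card {j. j < 12 \<and> \<not> 3 dvd a j}"
proof -
  have "wt12 a = (\<Sum>j\<in>{j \<in> {..<12}. \<not> 3 dvd a j}. 1)"
    unfolding wt12_def by (subst sum.inter_filter) (auto simp: nz_def intro: sum.cong)
  then show ?thesis by simp
qed

text \<open>For three rows: a combination of two of them vanishes at 5 places, and the third row is nonzero
  at 4 of those at least.\<close>

lemma light_info:
  assumes "wt12 a \<noteq> 0" "wt12 a \<le> 3"
  shows "7 \<le> wt12 a + wt12 (Xm a)"
proof -
  define J where "J = {j. j < 12 \<and> \<not> 3 dvd a j}"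
  have J: "J \<subseteq> {..<12}" "\<And>j. j \<in> J \<Longrightarrow> j < 12" "\<And>j. j \<in> J \<Longrightarrow> \<not> 3 dvd a j"
    by (auto simp: J_def)
  have "[Xm a l = (\<Sum>j\<in>J. X l j * a j)] (mod 3)" for l
  proof -
    have "Xm a l = (\<Sum>j\<in>J. X l j * a j) + (\<Sum>j\<in>{..<12} - J. X l j * a j)"
      unfolding Xm_def using J(1) by (simp add: sum.subset_diff add.commute)
    moreover have "3 dvd (\<Sum>j\<in>{..<12} - J. X l j * a j)"
      by (intro dvd_sum) (auto simp: J_def)
    ultimately show ?thesis by (simp add: cong_iff_dvd_diff)
  qed
  then have wtX: "wt12 (Xm a) = (\<Sum>l<12. nz (\<Sum>j\<in>J. X l j * a j))"
    unfolding wt12_def by (intro sum.cong refl nz_cong)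
  have card: "wt12 a = card J" by (simp add: wt12_card J_def)
  with assms have "card J = 1 \<or> card J = 2 \<or> card J = 3" by linarith
  then consider j where "J = {j}" | j k where "J = {j, k}" "j \<noteq> k"
    | j k i where "J = {j, k, i}" "j \<noteq> k" "j \<noteq> i" "k \<noteq> i"
    by (auto simp: card_1_singleton_iff card_2_iff card_3_iff)
  then show ?thesis
  proof cases
    case 1
    then have "wt12 (Xm a) = (\<Sum>l<12. nz (X l j))"
      using J(3) unfolding wtX by (simp add: mult.commute nz_mult)
    then show ?thesis using wt_single[of j] J(2) 1 by simp
  next
    case 2
    then have "wt12 (Xm a) = (\<Sum>l<12. nz (X l j * a j + X l k * a k))"
      unfolding wtX by simp
    then show ?thesis using wt_pair[of j k "a j" "a k"] J(2,3) 2 card by simp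
  next
    case 3
    have "(\<Sum>l<12. nz (X l i * a i))
        \<le> (\<Sum>l<12. nz (X l j * a j + X l k * a k + X l i * a i) + nz (X l j * a j + X l k * a k))"
      by (intro sum_mono nz_triangle)
    also have "\<dots> = wt12 (Xm a) + (\<Sum>l<12. nz (X l j * a j + X l k * a k))"
      unfolding wtX sum.distrib using 3 by (simp add: add.assoc)
    also have "(\<Sum>l<12. nz (X l j * a j + X l k * a k)) = 7"
      using wt_pair[of j k "a j" "a k"] J(2,3) 3 by simp
    also have "(\<Sum>l<12. nz (X l i * a i)) = 11"
      using wt_single[of i] J(2,3) 3 by (simp add: mult.commute nz_mult)
    finally show ?thesis using card 3 by simp
  qed
qed

lemma wt12_cong_square: "[int (wt12 a) = (\<Sum>j<12. a j * a j)] (mod 3)"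
  unfolding wt12_def of_nat_sum
  by (intro cong_sum) (metis cong_nz_square power2_eq_square)

text \<open>The weight is divisible by 3, so a counterexample has weight at most 3 in one half. The two
  halves are interchangeable because \<open>X\<^sup>2 = 11 I\<close>.\<close>

lemma block_code_weight:
  assumes "wt12 a \<noteq> 0"
  shows "9 \<le> wt12 a + wt12 (Xm a)"
proof (rule ccontr)
  assume less: "\<not> ?thesis"
  have Xm2: "wt12 (Xm (Xm a)) = wt12 a"
  proof -
    have "nz (11 * z) = nz z" for z by (rule nz_mult) simp
    then show ?thesis by (simp add: wt12_def Xm_Xm)
  qed
  have "[int (wt12 a) + int (wt12 (Xm a))
      = (\<Sum>j<12. a j * a j) + (\<Sum>j<12. Xm a j * Xm a j)] (mod 3)"
    by (intro cong_add wt12_cong_square)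
  also have "(\<Sum>j<12. Xm a j * Xm a j) = (\<Sum>j<12. 11 * (a j * a j))"
    unfolding Xm_adjoint by (intro sum.cong refl) (simp add: Xm_Xm)
  also have "(\<Sum>j<12. a j * a j) + (\<Sum>j<12. 11 * (a j * a j)) = 3 * (4 * (\<Sum>j<12. a j * a j))"
    by (simp flip: sum_distrib_left)
  finally have "3 dvd int (wt12 a + wt12 (Xm a))"
    by (simp add: cong_dvd_iff)
  then have dvd: "3 dvd wt12 a + wt12 (Xm a)" by presburger
  with less have le: "wt12 a + wt12 (Xm a) \<le> 6" by presburger
  then have "wt12 a \<le> 3 \<or> wt12 (Xm a) \<le> 3" by linarith
  then show False
  proof
    assume "wt12 a \<le> 3"
    then show False using light_info[OF assms] le by linarith
  next
    assume small: "wt12 (Xm a) \<le> 3"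
    have "wt12 (Xm a) \<noteq> 0"
    proof
      assume "wt12 (Xm a) = 0"
      then have "[Xm (Xm a) l = Xm (\<lambda>_. 0) l] (mod 3)" for l
        by (intro Xm_cong_mod) (simp add: wt12_eq_0_iff cong_0_iff)
      then have "wt12 (Xm (Xm a)) = 0"
        by (simp add: wt12_eq_0_iff Xm_def[of "\<lambda>_. 0"] cong_0_iff)
      then show False using Xm2 assms by simp
    qed
    then show False using light_info[of "Xm a"] small Xm2 le by linarith
  qed
qed

text \<open>The weight bounds the norm. For \<open>\<gamma>\<close> nonzero modulo 3 the block is a
  codeword shifted by a glue word of weight 4, so its weight is 4 or at least 9 - 4. Otherwise it
  lifts a codeword; a nonzero lift of the zero word has an entry of absolute value at least
  3.\<close>

lemma block_norm:
  assumes b: "\<And>l. l < 12 \<Longrightarrow> [b l = Xm a l + \<gamma> * glue l] (mod 3)"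
  defines "N \<equiv> (\<Sum>j<12. (a j)\<^sup>2) + (\<Sum>l<12. (b l)\<^sup>2)"
  shows "\<not> 3 dvd \<gamma> \<Longrightarrow> 4 \<le> N"
    and "3 dvd \<gamma> \<Longrightarrow> j < 12 \<Longrightarrow> a j \<noteq> 0 \<or> b j \<noteq> 0 \<Longrightarrow> 9 \<le> N"
proof -
  have wt_N: "int (wt12 a + wt12 b) \<le> N"
    unfolding wt12_def N_def of_nat_add of_nat_sum by (intro add_mono sum_mono nz_le_square)
  {
    assume \<gamma>: "\<not> 3 dvd \<gamma>"
    show "4 \<le> N"
    proof (cases "wt12 a = 0")
      case True
      then have "[Xm a l = Xm (\<lambda>_. 0) l] (mod 3)" for l
        by (intro Xm_cong_mod) (simp add: wt12_eq_0_iff cong_0_iff)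
      then have "[Xm a l = 0] (mod 3)" for l by (simp add: Xm_def[of "\<lambda>_. 0"])
      then have "[Xm a l + \<gamma> * glue l = 0 + \<gamma> * glue l] (mod 3)" for l
        by (intro cong_add cong_refl)
      then have "[b l = \<gamma> * glue l] (mod 3)" if "l < 12" for l
        using b[OF that] by (metis add_0 cong_trans)
      then have "nz (b l) = nz (glue l)" if "l < 12" for l
        using that nz_cong nz_mult[OF \<gamma>] by metis
      then have "wt12 b = wt12 glue" by (simp add: wt12_def)
      then show ?thesis using wt_N wt_glue by linarith
    next
      case False
      have "wt12 (Xm a) \<le> (\<Sum>l<12. nz (b l) + nz (glue l))"
        unfolding wt12_def
      proof (intro sum_mono)
        fix l :: nat assume "l \<in> {..<12}"
        then have "nz (b l) = nz (\<gamma> * glue l + Xm a l)"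
          using b[of l] by (intro nz_cong) (simp add: add.commute)
        then show "nz (Xm a l) \<le> nz (b l) + nz (glue l)"
          using nz_triangle[of "Xm a l" "\<gamma> * glue l"] nz_mult[OF \<gamma>] by simp
      qed
      also have "\<dots> = wt12 b + 4" using wt_glue by (simp add: wt12_def sum.distrib)
      finally show ?thesis using block_code_weight[OF False] wt_N by linarith
    qed
  }
  {
    assume \<gamma>: "3 dvd \<gamma>" and j: "j < 12" "a j \<noteq> 0 \<or> b j \<noteq> 0"
    have bX: "[b l = Xm a l] (mod 3)" if "l < 12" for l
    proof -
      have "[Xm a l + \<gamma> * glue l = Xm a l] (mod 3)"
        using \<gamma> by (simp add: cong_iff_dvd_diff)
      then show ?thesis using b[OF that] cong_trans by blast
    qed
    show "9 \<le> N"
    proof (cases "wt12 a = 0")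
      case True
      then have "[Xm a l = Xm (\<lambda>_. 0) l] (mod 3)" for l
        by (intro Xm_cong_mod) (simp add: wt12_eq_0_iff cong_0_iff)
      then have "[b l = 0] (mod 3)" if "l < 12" for l
        using bX[OF that] cong_trans by (fastforce simp: Xm_def[of "\<lambda>_. 0"])
      then have dvd: "3 dvd a j" "3 dvd b j"
        using True j(1) by (auto simp: wt12_eq_0_iff cong_0_iff)
      have sq: "9 \<le> z\<^sup>2" if "3 dvd z" "z \<noteq> 0" for z :: int
      proof -
        have "3 \<le> \<bar>z\<bar>" using that by presburger
        then have "3\<^sup>2 \<le> \<bar>z\<bar>\<^sup>2" by (intro power_mono) auto
        then show ?thesis by simp
      qed
      have "(a j)\<^sup>2 \<le> (\<Sum>j<12. (a j)\<^sup>2)" "(b j)\<^sup>2 \<le> (\<Sum>j<12. (b j)\<^sup>2)"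
        using j(1) by (auto intro!: member_le_sum)
      moreover have "0 \<le> (\<Sum>j<12. (a j)\<^sup>2)" "0 \<le> (\<Sum>j<12. (b j)\<^sup>2)"
        by (simp_all add: sum_nonneg)
      ultimately show ?thesis using j(2) sq[OF dvd(1)] sq[OF dvd(2)] unfolding N_def by linarith
    next
      case False
      have "wt12 b = wt12 (Xm a)"
        unfolding wt12_def by (intro sum.cong refl nz_cong bX) simp
      then show ?thesis using block_code_weight[OF False] wt_N by linarith
    qed
  }
qed

section \<open>Cyclic gluing of blocks\<close>

lemma sum_blocks:
  fixes f :: "nat \<Rightarrow> 'a :: comm_monoid_add"
  shows "(\<Sum>t<12 * m. f t) = (\<Sum>i<m. \<Sum>j<12. f (12 * i + j))"
proof (induction m)
  case (Suc m)
  have "12 * Suc m = 12 * m + 12" by simp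
  then show ?case by (simp only: sum_lessThan_add Suc sum.lessThan_Suc)
qed simp

locale glued_blocks =
  fixes m :: nat
  assumes m_pos: "0 < m"
begin

text \<open>The blocks form a cycle. For \<open>m = 1\<close> the only block is its own neighbour,
  and the gluing terms cancel.\<close>

definition prv :: "nat \<Rightarrow> nat" where
  "prv i = (if i = 0 then m - 1 else i - 1)"

definition nxt :: "nat \<Rightarrow> nat" where
  "nxt i = (if Suc i = m then 0 else Suc i)"

lemma prv_less: "i < m \<Longrightarrow> prv i < m"
  and nxt_less: "i < m \<Longrightarrow> nxt i < m"
  and nxt_prv: "i < m \<Longrightarrow> nxt (prv i) = i"
  and prv_nxt: "i < m \<Longrightarrow> prv (nxt i) = i"
  using m_pos by (auto simp: prv_def nxt_def)

lemma sum_prv: "(\<Sum>i<m. f (prv i)) = (\<Sum>i<m. f i)"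
  by (rule sum.reindex_bij_witness[of _ nxt prv])
    (auto simp: prv_less nxt_less nxt_prv prv_nxt)

text \<open>Block \<open>i\<close> of the parity half is \<open>X a\<^sub>i + (\<Lambda>\<^sub>i\<^sub>-\<^sub>1 - \<Lambda>\<^sub>i) glue\<close>, where \<open>a\<^sub>i\<close> is block \<open>i\<close> of the
  information half and \<open>\<Lambda>\<^sub>i\<close> is the inner product of \<open>lam\<close> and \<open>a\<^sub>i\<close>.\<close>

definition P :: "nat \<Rightarrow> nat \<Rightarrow> int" where
  "P s t = (if t div 12 = s div 12 then X (s mod 12) (t mod 12) - lam (t mod 12) * glue (s mod 12) else 0)
     + (if t div 12 = prv (s div 12) then lam (t mod 12) * glue (s mod 12) else 0)"

sublocale ternary_construction "12 * m" P .

definition blk :: "(nat \<Rightarrow> int) \<Rightarrow> nat \<Rightarrow> nat \<Rightarrow> int" where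
  "blk x i j = x (12 * i + j)"

definition \<Lambda> :: "(nat \<Rightarrow> int) \<Rightarrow> nat \<Rightarrow> int" where
  "\<Lambda> x i = (\<Sum>j<12. lam j * blk x i j)"

section \<open>Block form of the parity map and its transpose; self-duality\<close>

lemma F_block:
  assumes "i < m" "l < 12"
  shows "F x (12 * i + l) = Xm (blk x i) l + (\<Lambda> x (prv i) - \<Lambda> x i) * glue l"
proof -
  \<comment> \<open>The two summands are kept apart because \<open>prv i = i\<close> when
    \<open>m = 1\<close>.\<close>
  have "F x (12 * i + l) = (\<Sum>k<m. \<Sum>j<12.
      (if k = i then (X l j - lam j * glue l) * blk x k j else 0)
      + (if k = prv i then lam j * glue l * blk x k j else 0))"
    unfolding F_def sum_blocks
    by (intro sum.cong refl) (use assms in \<open>auto simp: P_def blk_def algebra_simps\<close>)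
  also have "\<dots> = (\<Sum>k<m. (if k = i then (\<Sum>j<12. (X l j - lam j * glue l) * blk x k j) else 0)
      + (if k = prv i then (\<Sum>j<12. lam j * glue l * blk x k j) else 0))"
    by (intro sum.cong refl) (auto simp: sum.distrib)
  also have "\<dots> = (\<Sum>j<12. (X l j - lam j * glue l) * blk x i j)
      + (\<Sum>j<12. lam j * glue l * blk x (prv i) j)"
    using assms prv_less by (simp add: sum.distrib)
  also have "(\<Sum>j<12. (X l j - lam j * glue l) * blk x i j) = Xm (blk x i) l - \<Lambda> x i * glue l"
    by (simp add: Xm_def \<Lambda>_def algebra_simps sum_subtractf sum_distrib_left)
  also have "(\<Sum>j<12. lam j * glue l * blk x (prv i) j) = \<Lambda> x (prv i) * glue l"
    by (simp add: \<Lambda>_def algebra_simps sum_distrib_left)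
  finally show ?thesis by (simp add: algebra_simps)
qed

text \<open>The counterpart of \<open>\<Lambda>\<close> for the transposed map
  \<open>G\<close>.\<close>

definition B :: "(nat \<Rightarrow> int) \<Rightarrow> nat \<Rightarrow> int" where
  "B y i = (\<Sum>l<12. glue l * blk y i l)"

lemma G_block:
  assumes "i < m" "j < 12"
  shows "G y (12 * i + j) = Xm (blk y i) j + (B y (nxt i) - B y i) * lam j"
proof -
  \<comment> \<open>Transposing turns the predecessor into the successor.\<close>
  have prv_iff: "i = prv k \<longleftrightarrow> k = nxt i" if "k < m" for k
    using that assms(1) nxt_prv prv_nxt by metis
  have "G y (12 * i + j) = (\<Sum>k<m. \<Sum>l<12.
      (if k = i then (X l j - lam j * glue l) * blk y k l else 0)
      + (if k = nxt i then lam j * glue l * blk y k l else 0))"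
    unfolding G_def sum_blocks
    by (intro sum.cong refl) (use assms in \<open>auto simp: P_def blk_def algebra_simps prv_iff\<close>)
  also have "\<dots> = (\<Sum>k<m. (if k = i then (\<Sum>l<12. (X l j - lam j * glue l) * blk y k l) else 0)
      + (if k = nxt i then (\<Sum>l<12. lam j * glue l * blk y k l) else 0))"
    by (intro sum.cong refl) (auto simp: sum.distrib)
  also have "\<dots> = (\<Sum>l<12. (X l j - lam j * glue l) * blk y i l)
      + (\<Sum>l<12. lam j * glue l * blk y (nxt i) l)"
    using assms nxt_less by (simp add: sum.distrib)
  also have "(\<Sum>l<12. (X l j - lam j * glue l) * blk y i l)
      = (\<Sum>l<12. X j l * blk y i l - lam j * (glue l * blk y i l))"
    by (intro sum.cong refl) (use assms X_sym in \<open>auto simp: algebra_simps\<close>)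
  also have "\<dots> = Xm (blk y i) j - B y i * lam j"
    by (simp add: Xm_def B_def algebra_simps sum_subtractf sum_distrib_left)
  also have "(\<Sum>l<12. lam j * glue l * blk y (nxt i) l) = B y (nxt i) * lam j"
    by (simp add: B_def algebra_simps sum_distrib_left)
  finally show ?thesis by (simp add: algebra_simps)
qed

text \<open>Modulo 3, both -11 and 55 are 1, so the glue terms of block \<open>i\<close> amount to
  \<open>\<Lambda> x * \<Lambda> y\<close> at \<open>prv i\<close> minus its value at
  \<open>i\<close>. This telescopes around the cycle; the rest cancels because 11 + 1 = 12.\<close>

lemma isometry: "[(\<Sum>s<12 * m. F x s * F y s) = - (\<Sum>t<12 * m. x t * y t)] (mod 3)"
proof -
  define d where "d x i = \<Lambda> x (prv i) - \<Lambda> x i" for x i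
  define D where "D i = (\<Sum>j<12. blk x i j * blk y i j)" for i
  have block: "(\<Sum>l<12. F x (12 * i + l) * F y (12 * i + l))
      = 11 * D i - 11 * (d y i * \<Lambda> x i + d x i * \<Lambda> y i) + 55 * (d x i * d y i)"
    if "i < m" for i
  proof -
    have "(\<Sum>l<12. F x (12 * i + l) * F y (12 * i + l))
        = (\<Sum>l<12. (Xm (blk x i) l + d x i * glue l) * (Xm (blk y i) l + d y i * glue l))"
      by (intro sum.cong refl) (simp add: F_block that d_def)
    also have "\<dots> = (\<Sum>l<12. Xm (blk x i) l * Xm (blk y i) l)
          + d y i * (\<Sum>l<12. Xm (blk x i) l * glue l)
          + d x i * (\<Sum>l<12. Xm (blk y i) l * glue l) + d x i * d y i * (\<Sum>l<12. glue l * glue l)"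
      by (simp add: algebra_simps sum.distrib sum_distrib_left)
    also have "(\<Sum>l<12. Xm (blk x i) l * Xm (blk y i) l) = 11 * D i"
      unfolding Xm_adjoint D_def sum_distrib_left by (intro sum.cong refl) (simp add: Xm_Xm)
    finally show ?thesis
      unfolding sum_Xm_glue sum_glue_glue \<Lambda>_def[symmetric] by (simp add: algebra_simps)
  qed
  have telescope: "(\<Sum>i<m. \<Lambda> x (prv i) * \<Lambda> y (prv i) - \<Lambda> x i * \<Lambda> y i) = 0"
    using sum_prv[of "\<lambda>i. \<Lambda> x i * \<Lambda> y i"] by (simp add: sum_subtractf)
  have "(\<Sum>s<12 * m. F x s * F y s) + (\<Sum>t<12 * m. x t * y t)
      = (\<Sum>i<m. (\<Sum>l<12. F x (12 * i + l) * F y (12 * i + l)) + D i)"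
    unfolding sum_blocks by (simp add: sum.distrib D_def blk_def)
  also have "\<dots> = (\<Sum>i<m. 3 * (4 * D i - 4 * (d y i * \<Lambda> x i + d x i * \<Lambda> y i) + 18 * (d x i * d y i))
      + (\<Lambda> x (prv i) * \<Lambda> y (prv i) - \<Lambda> x i * \<Lambda> y i))"
  proof (intro sum.cong refl)
    fix i assume "i \<in> {..<m}"
    then have i: "i < m" by simp
    show "(\<Sum>l<12. F x (12 * i + l) * F y (12 * i + l)) + D i
        = 3 * (4 * D i - 4 * (d y i * \<Lambda> x i + d x i * \<Lambda> y i) + 18 * (d x i * d y i))
          + (\<Lambda> x (prv i) * \<Lambda> y (prv i) - \<Lambda> x i * \<Lambda> y i)"
      unfolding block[OF i] by (simp add: d_def algebra_simps)
  qed
  also have "\<dots> = 3 * (\<Sum>i<m. 4 * D i - 4 * (d y i * \<Lambda> x i + d x i * \<Lambda> y i) + 18 * (d x i * d y i))"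
    by (subst sum.distrib) (simp only: telescope sum_distrib_left[symmetric] add_0_right)
  finally have "3 dvd (\<Sum>s<12 * m. F x s * F y s) + (\<Sum>t<12 * m. x t * y t)" by simp
  then show ?thesis by (simp add: cong_iff_dvd_diff)
qed

lemma block_index:
  assumes "s < 12 * m"
  obtains i l where "i < m" "l < 12" "s = 12 * i + l"
  using that[of "s div 12" "s mod 12"] assms by (simp add: less_mult_imp_div_less mult.commute)

text \<open>The glue terms of \<open>F (G y)\<close> add up to a multiple of 6, which leaves
  \<open>11 * y s\<close>, that is \<open>- y s\<close> modulo 3.\<close>

lemma coisometry:
  assumes "s < 12 * m"
  shows "[F (G y) s = - y s] (mod 3)"
proof -
  obtain i l where il: "i < m" "l < 12" "s = 12 * i + l" using assms by (rule block_index)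
  define \<delta> where "\<delta> k = B y (nxt k) - B y k" for k
  have blk_G: "blk (G y) k j = Xm (blk y k) j + \<delta> k * lam j" if "k < m" "j < 12" for k j
    using G_block[OF that] by (simp add: blk_def[of "G y"] \<delta>_def)
  have \<Lambda>_G: "\<Lambda> (G y) k = - B y k + 5 * \<delta> k" if "k < m" for k
  proof -
    have "\<Lambda> (G y) k = (\<Sum>j<12. lam j * (Xm (blk y k) j + \<delta> k * lam j))"
      unfolding \<Lambda>_def by (intro sum.cong refl) (simp add: blk_G that)
    also have "\<dots> = (\<Sum>j<12. Xm (blk y k) j * lam j) + \<delta> k * (\<Sum>j<12. lam j * lam j)"
      by (simp add: algebra_simps sum.distrib sum_distrib_left)
    also have "(\<Sum>j<12. Xm (blk y k) j * lam j) = - B y k"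
      unfolding Xm_adjoint B_def glue_def by (simp add: sum_negf mult.commute)
    finally show ?thesis by (simp add: sum_lam_lam)
  qed
  have "F (G y) s = Xm (blk (G y) i) l + (\<Lambda> (G y) (prv i) - \<Lambda> (G y) i) * glue l"
    using F_block il by simp
  also have "Xm (blk (G y) i) l = Xm (\<lambda>j. Xm (blk y i) j + \<delta> i * lam j) l"
    by (rule Xm_cong) (simp add: blk_G il(1))
  also have "\<dots> = 11 * y s - \<delta> i * glue l"
    using il by (simp add: Xm_add Xm_mult Xm_Xm glue_def blk_def)
  also have "\<Lambda> (G y) (prv i) - \<Lambda> (G y) i = 6 * \<delta> (prv i) - 5 * \<delta> i"
    using il(1) by (simp add: \<Lambda>_G prv_less \<delta>_def nxt_prv)
  finally have "F (G y) s - - y s = 3 * (4 * y s + 2 * (\<delta> (prv i) - \<delta> i) * glue l)"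
    by (simp add: algebra_simps)
  then show ?thesis unfolding cong_iff_dvd_diff by (metis dvd_triv_left)
qed

section \<open>Minimum norm of the glued lattice\<close>

lemma sum_blocks_both:
  "(\<Sum>t<12 * m + 12 * m. f t)
    = (\<Sum>i<m. (\<Sum>j<12. f (12 * i + j)) + (\<Sum>l<12. f (12 * m + (12 * i + l))))"
  unfolding sum_lessThan_add sum_blocks by (rule sum.distrib[symmetric])

lemma norm_ge_9:
  assumes x: "x \<in> code" and t: "t < 12 * m + 12 * m" "x t \<noteq> 0"
  shows "9 \<le> (\<Sum>s<12 * m + 12 * m. (x s)\<^sup>2)"
proof -
  define a where "a i = blk x i" for i
  define b where "b i l = x (12 * m + (12 * i + l))" for i l
  define \<gamma> where "\<gamma> i = \<Lambda> x (prv i) - \<Lambda> x i" for i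
  define N where "N i = (\<Sum>j<12. (a i j)\<^sup>2) + (\<Sum>l<12. (b i l)\<^sup>2)" for i
  have b: "[b i l = Xm (a i) l + \<gamma> i * glue l] (mod 3)" if "i < m" "l < 12" for i l
  proof -
    have "12 * i + l < 12 * m" using that by linarith
    then have "[b i l = F x (12 * i + l)] (mod 3)"
      using x unfolding code_def b_def by blast
    then show ?thesis by (simp only: F_block[OF that] a_def \<gamma>_def)
  qed
  have total: "(\<Sum>s<12 * m + 12 * m. (x s)\<^sup>2) = (\<Sum>i<m. N i)"
    unfolding sum_blocks_both by (simp add: N_def a_def b_def blk_def)
  have N_nonneg: "0 \<le> N i" for i by (simp add: N_def sum_nonneg)
  \<comment> \<open>This divisibility later lifts the bound 8 to 9.\<close>
  have dvd: "3 dvd (\<Sum>i<m. N i)"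
    using code_self_orthogonal[OF isometry x x] total by (simp add: power2_eq_square)
  show ?thesis
  proof (cases "\<exists>i<m. \<not> 3 dvd \<gamma> i")
    case True
    then obtain i where i: "i < m" "\<not> 3 dvd \<gamma> i" by blast
    \<comment> \<open>The glue coefficients telescope, so one that is nonzero modulo 3 forces a
      second one.\<close>
    have "(\<Sum>i<m. \<gamma> i) = 0" by (simp add: \<gamma>_def sum_subtractf sum_prv)
    then have "\<gamma> i = - (\<Sum>k\<in>{..<m} - {i}. \<gamma> k)"
      using i(1) by (simp add: sum.remove[of "{..<m}" i])
    with i(2) obtain k where k: "k < m" "k \<noteq> i" "\<not> 3 dvd \<gamma> k"
      by (metis DiffE dvd_minus_iff dvd_sum insertI1 lessThan_iff)
    have "4 + 4 \<le> N i + N k"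
      using block_norm(1)[of "b i" "a i" "\<gamma> i"] block_norm(1)[of "b k" "a k" "\<gamma> k"] b i k
      unfolding N_def by (intro add_mono) auto
    also have "\<dots> = (\<Sum>j\<in>{i, k}. N j)" using k(2) by simp
    also have "\<dots> \<le> (\<Sum>i<m. N i)"
      using i(1) k(1) N_nonneg by (intro sum_mono2) auto
    finally have "8 \<le> (\<Sum>i<m. N i)" by simp
    then show ?thesis using dvd unfolding total by presburger
  next
    case False
    obtain i j where ij: "i < m" "j < 12" "a i j \<noteq> 0 \<or> b i j \<noteq> 0"
    proof (cases "t < 12 * m")
      case True
      then show ?thesis using t that by (auto elim: block_index simp: a_def blk_def)
    next
      case False
      then have "t - 12 * m < 12 * m" using t by linarith
      then obtain i l where "i < m" "l < 12" "t - 12 * m = 12 * i + l" by (rule block_index)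
      moreover from this False have "t = 12 * m + (12 * i + l)" by linarith
      ultimately show ?thesis using t(2) that[of i l] by (simp add: b_def)
    qed
    have "9 \<le> N i"
      using block_norm(2)[of "b i" "a i" "\<gamma> i" j] b ij False unfolding N_def by blast
    also have "\<dots> \<le> (\<Sum>i<m. N i)"
      using ij(1) N_nonneg by (intro member_le_sum) auto
    finally show ?thesis unfolding total .
  qed
qed

sublocale ternary_construction_min_3 "12 * m" P
  by unfold_locales (use m_pos norm_ge_9 in auto)

section \<open>Words of weight 9, generation and connectedness\<close>

definition place :: "nat \<Rightarrow> (nat \<Rightarrow> int) \<Rightarrow> nat \<Rightarrow> int" where
  "place i q t = (if t div 12 = i then q (t mod 12) else 0)"

lemma blk_place: "j < 12 \<Longrightarrow> blk (place i q) k j = (if k = i then q j else 0)"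
  by (simp add: blk_def place_def)

lemma F_place:
  assumes "k < m" "l < 12"
  shows "F (place i q) (12 * k + l) = (if k = i then Xm q l else 0)
    + ((if prv k = i then \<Sum>j<12. lam j * q j else 0) - (if k = i then \<Sum>j<12. lam j * q j else 0)) * glue l"
proof -
  have "Xm (blk (place i q) k) l = Xm (\<lambda>j. if k = i then q j else 0) l"
    by (rule Xm_cong) (simp add: blk_place)
  also have "\<dots> = (if k = i then Xm q l else 0)" by (simp add: Xm_def)
  finally show ?thesis
    using assms by (simp add: F_block \<Lambda>_def blk_place)
qed

lemma wt_enc: "wt (enc p) = (\<Sum>k<m. wt12 (blk p k) + (\<Sum>l<12. nz (F p (12 * k + l))))"
  unfolding wt_def sum_blocks_both
proof (intro sum.cong refl arg_cong2[of _ _ _ _ "(+)"])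
  fix k assume "k \<in> {..<m}"
  then have "12 * k + j < 12 * m" if "j < 12" for j using that by auto
  then show "(\<Sum>j<12. nz (enc p (12 * k + j))) = wt12 (blk p k)"
    by (simp add: wt12_def enc_def blk_def)
qed (simp add: enc_def)

lemma wt12_blk_place: "wt12 (blk (place i q) k) = (if k = i then wt12 q else 0)"
  by (simp add: wt12_def blk_place nz_def)

text \<open>Orthogonality to \<open>lam\<close> switches off the glue, so nothing spills into the
  next block.\<close>

lemma wt_place:
  assumes "i < m" "(\<Sum>j<12. lam j * q j) = 0"
  shows "wt (enc (place i q)) = wt12 q + wt12 (Xm q)"
proof -
  have "wt (enc (place i q)) = (\<Sum>k<m. if k = i then wt12 q + wt12 (Xm q) else 0)"
    unfolding wt_enc
    by (intro sum.cong refl) (auto simp: wt12_blk_place F_place assms(2) wt12_def[of "Xm q"] nz_def)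
  then show ?thesis using assms(1) by simp
qed

definition pair :: "nat \<Rightarrow> nat \<Rightarrow> int \<Rightarrow> nat \<Rightarrow> int" where
  "pair j k c t = (if t = j then 1 else 0) + (if t = k then c else 0)"

text \<open>These are the cases with \<open>c\<close> equal to 1 or -1 in which
  \<open>pair j k c\<close> is orthogonal to \<open>lam\<close>; its encoding then has weight 2 +
  7.\<close>

definition compatible :: "nat \<Rightarrow> nat \<Rightarrow> int \<Rightarrow> bool" where
  "compatible j k c \<longleftrightarrow> j < 12 \<and> k < 12 \<and> j \<noteq> k \<and>
     (if j < 5 then k < 5 \<and> c = -1 else 5 \<le> k \<and> (c = 1 \<or> c = -1))"

lemma Xm_pair: "j < 12 \<Longrightarrow> k < 12 \<Longrightarrow> Xm (pair j k c) l = X l j + X l k * c"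
  by (simp add: Xm_def pair_def algebra_simps sum.distrib if_distrib[of "(*) _"] cong: if_cong)

lemma wt_enc_pair:
  assumes "i < m" "compatible j k c"
  shows "wt (enc (place i (pair j k c))) = 9"
proof -
  have jk: "j < 12" "k < 12" "j \<noteq> k" "\<not> 3 dvd c"
    using assms(2) by (auto simp: compatible_def split: if_splits)
  have "(\<Sum>t<12. lam t * pair j k c t) = lam j + lam k * c"
    using jk by (simp add: pair_def algebra_simps sum.distrib if_distrib[of "(*) _"] cong: if_cong)
  also have "\<dots> = 0" using assms(2) by (auto simp: compatible_def lam_def split: if_splits)
  finally have "wt (enc (place i (pair j k c))) = wt12 (pair j k c) + wt12 (Xm (pair j k c))"
    by (rule wt_place[OF assms(1)])
  also have "wt12 (Xm (pair j k c)) = 7"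
    using wt_pair[of j k 1 c] jk by (simp add: wt12_def Xm_pair)
  also have "wt12 (pair j k c) = card {j, k}"
    unfolding wt12_card by (rule arg_cong[of _ _ card]) (use jk in \<open>auto simp: pair_def\<close>)
  finally show ?thesis using jk by simp
qed

text \<open>In its own block \<open>lam\<close> gives \<open>- glue\<close> from \<open>Xm\<close>
  and \<open>- 5 * glue\<close> from \<open>\<Lambda>\<close>, together zero modulo 3; the next
  block receives \<open>5 * glue\<close>.\<close>

lemma F_place_lam:
  assumes "k < m" "l < 12"
  shows "F (place i lam) (12 * k + l)
    = ((if prv k = i then 5 else 0) - (if k = i then 6 else 0)) * glue l"
  using F_place[OF assms, of i lam] by (simp add: sum_lam_lam glue_def)

lemma nz_F_place_lam:
  assumes "i < m" "k < m" "l < 12"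
  shows "nz (F (place i lam) (12 * k + l)) = (if k = nxt i then nz (glue l) else 0)"
proof -
  have iff: "prv k = i \<longleftrightarrow> k = nxt i" using assms nxt_prv prv_nxt by metis
  have *: "nz (c * glue l) = nz (glue l)" if "\<not> 3 dvd c" for c using that by (rule nz_mult)
  show ?thesis
    \<comment> \<open>The factor is 5 in general, and 5 - 6 = -1 when \<open>m = 1\<close> and the
      next block is the same one.\<close>
    using *[of 5] *[of "-1"] assms(2,3)
    by (auto simp: F_place_lam iff) (auto simp: nz_def)
qed

lemma wt_enc_lam:
  assumes "i < m"
  shows "wt (enc (place i lam)) = 9"
proof -
  have "wt (enc (place i lam)) = (\<Sum>k<m. (if k = i then wt12 lam else 0)
      + (if k = nxt i then wt12 glue else 0))"
    unfolding wt_enc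
    by (intro sum.cong refl) (simp add: wt12_blk_place nz_F_place_lam assms wt12_def[of glue])
  then show ?thesis using assms nxt_less by (simp add: sum.distrib wt_lam wt_glue)
qed

lemma unit_in_gen_info:
  assumes "s < 12 * m"
  shows "(\<lambda>t. if t = s then 1 else 0) \<in> gen_info"
proof -
  obtain i j where ij: "i < m" "j < 12" "s = 12 * i + j" using assms by (rule block_index)
  define e :: "nat \<Rightarrow> int" where "e t = (if t = j then 1 else 0)" for t
  have unit: "(\<lambda>t. if t = s then 1 else 0) = place i e"
  proof
    fix t :: nat
    have "t = s \<longleftrightarrow> t div 12 = i \<and> t mod 12 = j"
      using ij by (auto dest: arg_cong[of _ _ "\<lambda>z. z div 12"])
    then show "(if t = s then 1 else 0) = place i e t" by (simp add: place_def e_def)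
  qed
  have pair: "place i (pair j' k' c) \<in> gen_info" if "compatible j' k' c" for j' k' c
    by (rule gen_info_weight_9[OF wt_enc_pair[OF ij(1) that]])
  \<comment> \<open>Used for \<open>c = 2\<close> and \<open>c = 5\<close>, both of which are
    inverted by 2 modulo 3.\<close>
  have double: "place i e \<in> gen_info"
    if "(\<lambda>t. c * place i e t) \<in> gen_info" "[2 * c = 1] (mod 3)" for c
  proof -
    have "(\<lambda>t. 2 * (c * place i e t)) \<in> gen_info" using that(1) by (rule gen_info_scale)
    then show ?thesis
    proof (rule gen_info_cong)
      show "[2 * (c * place i e t) = place i e t] (mod 3)" for t
        using cong_scalar_right[OF that(2), of "place i e t"] by (simp add: mult.assoc)
    qed
  qed
  show ?thesis
  proof (cases "j < 5")
    case False
    \<comment> \<open>A partner of \<open>j\<close> among the places from 5 on: the sum and the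
      difference of the two unit words add up to twice the unit word at \<open>j\<close>.\<close>
    define k :: nat where "k = (if j = 5 then 6 else 5)"
    have "compatible j k 1" "compatible j k (-1)"
      using ij False by (auto simp: compatible_def k_def)
    then have "(\<lambda>t. place i (pair j k 1) t + place i (pair j k (-1)) t) \<in> gen_info"
      by (intro gen_info_add pair)
    also have "(\<lambda>t. place i (pair j k 1) t + place i (pair j k (-1)) t) = (\<lambda>t. 2 * place i e t)"
      by (auto simp: place_def pair_def e_def)
    finally show ?thesis unfolding unit by (rule double) (simp add: cong_def)
  next
    case True
    have "place i (pair j k (-1)) \<in> gen_info" if "k < 5" for k
    proof (cases "k = j")
      case True
      then have "place i (pair j k (-1)) = (\<lambda>t. 0)" by (auto simp: place_def pair_def)
      then show ?thesis using gen_info_0 by simp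
    next
      case False
      then show ?thesis using True that by (intro pair) (auto simp: compatible_def)
    qed
    \<comment> \<open>\<open>lam\<close> is the sum of the first five unit words, so adding the
      differences with each of them leaves \<open>5 * e\<close>; the term \<open>k = j\<close> is
      zero.\<close>
    then have "(\<lambda>t. place i lam t + (\<Sum>k<5. place i (pair j k (-1)) t)) \<in> gen_info"
      by (intro gen_info_add[OF gen_info_weight_9[OF wt_enc_lam[OF ij(1)]]] gen_info_sum) auto
    also have "(\<lambda>t. place i lam t + (\<Sum>k<5. place i (pair j k (-1)) t)) = (\<lambda>t. 5 * place i e t)"
      by (auto simp: place_def pair_def e_def lam_def sum.distrib)
    finally show ?thesis unfolding unit by (rule double) (simp add: cong_def)
  qed
qed

text \<open>Pair words join every coordinate of a block to its first information coordinate, and the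
  glue words then carry the colour around the cycle.\<close>

lemma connected:
  fixes \<sigma> :: "nat \<Rightarrow> bool"
  assumes \<sigma>: "\<And>x s t. \<lbrakk>x \<in> code; wt x = 9; s < 12 * m + 12 * m; t < 12 * m + 12 * m;
      \<not> 3 dvd x s; \<not> 3 dvd x t\<rbrakk> \<Longrightarrow> \<sigma> s = \<sigma> t"
  shows "\<forall>s<12 * m + 12 * m. \<forall>t<12 * m + 12 * m. \<sigma> s = \<sigma> t"
proof -
  have bound: "12 * i + j < 12 * m" if "i < m" "j < 12" for i j :: nat
    using that by linarith
  have enc_info: "enc p (12 * i + j) = blk p i j" if "i < m" "j < 12" for p i j
    using bound[OF that] by (simp add: enc_def blk_def)
  have enc_parity: "enc p (12 * m + s) = F p s" for p s
    by (simp add: enc_def)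
  have F_pair: "F (place i (pair j k c)) (12 * i + l) = X l j + X l k * c
      + (if prv i = i then 0 else - (lam j + lam k * c) * glue l)"
    if "i < m" "j < 12" "k < 12" "l < 12" for i j k c l
  proof -
    have "(\<Sum>t<12. lam t * pair j k c t) = lam j + lam k * c"
      using that by (simp add: pair_def algebra_simps sum.distrib if_distrib[of "(*) _"] cong: if_cong)
    then show ?thesis using that by (simp add: F_place Xm_pair)
  qed
  have lam_compatible: "lam j + lam k * c = 0" if "compatible j k c" for j k c
    using that by (auto simp: compatible_def lam_def split: if_splits)
  have info: "\<sigma> (12 * i + j) = \<sigma> (12 * i + k)" if "i < m" "compatible j k c" for i j k c
    by (rule \<sigma>[OF enc_in_code wt_enc_pair[OF that]])
      (use that bound in \<open>auto simp: compatible_def enc_info blk_place pair_def trans_less_add1 split: if_splits\<close>)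
  have parity: "\<sigma> (12 * i + j) = \<sigma> (12 * m + (12 * i + l))"
    if "i < m" "compatible j k c" "l < 12" "\<not> 3 dvd X l j + X l k * c" for i j k c l
  proof (rule \<sigma>[OF enc_in_code wt_enc_pair[OF that(1,2)]])
    have jk: "j < 12" "k < 12" "j \<noteq> k" using that(2) by (auto simp: compatible_def)
    show "12 * i + j < 12 * m + 12 * m" "12 * m + (12 * i + l) < 12 * m + 12 * m"
      using bound jk that by (simp_all add: trans_less_add1)
    show "\<not> 3 dvd enc (place i (pair j k c)) (12 * i + j)"
      using jk that(1) by (simp add: enc_info blk_place) (simp add: pair_def)
    show "\<not> 3 dvd enc (place i (pair j k c)) (12 * m + (12 * i + l))"
      unfolding enc_parity using that jk lam_compatible[OF that(2)] by (simp add: F_pair)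
  qed
  have glue: "\<sigma> (12 * i) = \<sigma> (12 * m + (12 * nxt i + l))"
    if "i < m" "l < 12" "\<not> 3 dvd glue l" for i l
  proof (rule \<sigma>[OF enc_in_code wt_enc_lam[OF that(1)]])
    show "12 * i < 12 * m + 12 * m" "12 * m + (12 * nxt i + l) < 12 * m + 12 * m"
      using bound[of "nxt i" l] nxt_less that by simp_all
    show "\<not> 3 dvd enc (place i lam) (12 * i)"
      using enc_info[of i 0 "place i lam"] that(1) by (simp add: blk_place) (simp add: lam_def)
    have "nz (enc (place i lam) (12 * m + (12 * nxt i + l))) = nz (glue l)"
      unfolding enc_parity using nz_F_place_lam[OF that(1) _ that(2), of "nxt i"] nxt_less that(1) by simp
    then show "\<not> 3 dvd enc (place i lam) (12 * m + (12 * nxt i + l))"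
      using that(3) by (simp add: nz_def split: if_splits)
  qed
  have light: "\<sigma> (12 * i + j) = \<sigma> (12 * i)" if "i < m" "j < 5" for i j
    using info[OF that(1), of 0 j "-1"] that by (cases "j = 0") (auto simp: compatible_def)
  have par: "\<sigma> (12 * m + (12 * i + l)) = \<sigma> (12 * i)" if "i < m" "l < 12" for i l
  proof -
    obtain j k where jk: "j < 5" "k < 5" "\<not> 3 dvd X l j - X l k"
      using X_nonconst \<open>l < 12\<close> by blast
    then have "compatible j k (-1)" by (auto simp: compatible_def)
    then show ?thesis using parity[OF that(1) _ that(2), of j k "-1"] light[OF that(1)] jk by simp
  qed
  \<comment> \<open>No compatible pair mixes places below 5 with the others. Parity place 0 joins
    the two classes, because columns 5 and 6 differ there by 2.\<close>
  have "X 0 5 = 1" "X 0 6 = -1" by (simp_all add: X_def X_rows_def)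
  then have five: "\<sigma> (12 * i + 5) = \<sigma> (12 * i)" if "i < m" for i
    using parity[OF that, of 5 6 "-1" 0] par[OF that, of 0] by (simp add: compatible_def)
  have block: "\<sigma> (12 * i + j) = \<sigma> (12 * i)" if "i < m" "j < 12" for i j
  proof (cases "j < 5")
    case False
    then show ?thesis
      using info[OF that(1), of 5 j 1] five[OF that(1)] that(2) by (cases "j = 5") (auto simp: compatible_def)
  qed (use light that in auto)
  have "\<exists>l<12. \<not> 3 dvd glue l" using wt_glue wt12_eq_0_iff[of glue] by auto
  then have step: "\<sigma> (12 * nxt i) = \<sigma> (12 * i)" if "i < m" for i
    using glue that par nxt_less by metis
  have start: "\<sigma> (12 * i) = \<sigma> 0" if "i < m" for i
    using that
  proof (induction i)
    case (Suc i)
    then show ?case using step[of i] by (simp add: nxt_def)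
  qed simp
  have "\<sigma> t = \<sigma> 0" if t: "t < 12 * m + 12 * m" for t
  proof (cases "t < 12 * m")
    case True
    then obtain i j where "i < m" "j < 12" "t = 12 * i + j" by (rule block_index)
    then show ?thesis using block start by simp
  next
    case False
    with t have "t - 12 * m < 12 * m" by linarith
    then obtain i l where il: "i < m" "l < 12" "t - 12 * m = 12 * i + l" by (rule block_index)
    with False have "t = 12 * m + (12 * i + l)" by linarith
    then show ?thesis using par start il by simp
  qed
  then show ?thesis by blast
qed

lemma properties:
  "odd_unimodular (24 * m) L \<and> irreducible_lattice (24 * m) L \<and> min_norm (24 * m) L = 3 \<and>
   integrable_lattice 3 (24 * m) L \<and> generated_by_min_vecs (24 * m) L"
proof -
  have dim: "24 * m = 12 * m + 12 * m" by simp
  have "irreducible_lattice (12 * m + 12 * m) L"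
    by (rule irreducible_L) (rule connected)
  moreover have "odd_unimodular (12 * m + 12 * m) L"
    by (rule odd_unimodular_L) (rule isometry, rule coisometry)
  moreover have "generated_by_min_vecs (12 * m + 12 * m) L"
    by (rule generated_L) (rule unit_in_gen_info)
  moreover have "integrable_lattice 3 (12 * m + 12 * m) L"
    by (rule integrable_L) (use m_pos in simp)
  ultimately show ?thesis
    unfolding dim using min_norm_L by blast
qed

end

theorem theorem1p1:
  fixes m :: nat
  assumes "m > 0"
  shows "\<exists>L. odd_unimodular (24 * m) L \<and> irreducible_lattice (24 * m) L \<and>
             min_norm (24 * m) L = 3 \<and> integrable_lattice 3 (24 * m) L \<and>
             generated_by_min_vecs (24 * m) L"
proof -
  interpret glued_blocks m using assms by unfold_locales
  show ?thesis using properties by blast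
qed

end
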